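(* For every $M\in\mathbb N$, $\overline{\overline d}=0$, where $\overline{\overline d}=\frac1{M+1}\sum_{T=0}^M\overline d(T,M+1)$.
   Context: Fix integers $M\ge1$, $q\ge2$. The augmented state set is $\overline S=\{(b_1,\dots,b_M,d;T,t): b_m,d,T\in\mathbb Z,\ 1\le t\le M+1,\ d+T+\sum_{m=1}^M b_m=0\}$, the BDM state set is $S=\{s\in\overline S:0\le T\le M\}$, $S(T_0,t_0)=\{s\in S:T=T_0,t=t_0\}$; initial state $s_0=(0,\dots,0,0;0,M+1)$; $d(s)$ denotes the $d$-coordinate of $s$. The BDM is the Markov chain on $S$ with transitions from $s=(b_1,\dots,b_M,d;T,t)$: if $t\le M$ and $b_t>d$, with probability $(q-1)/q$ to $(b_1,\dots,b_{t-1},d,b_{t+1},\dots,b_M,b_t;T,t+1)$ and with probability $1/q$ to $(b_1,\dots,b_M,d;T,t+1)$; if $t\le M$ and $b_t\le d$, with probability 1 to $(b_1,\dots,b_M,d;T,t+1)$; if $t=M+1,T<M$, with probability 1 to $(b_1,\dots,b_M,d-1;T+1,1)$; if $t=M+1,T=M$, with probability 1 to $(b_1+1,\dots,b_M+1,d;0,1)$. Let $\mu_0$ be the point mass at $s_0$, $\mu_{\tau+1}(s')=\sum_s\mu_\tau(s)p(s,s')$, and $\mu_\infty(s)=\limsup_{\tau\to\infty}\mu_\tau(s)$. Define $\overline d(T,t)=\sum_{s\in S(T,t)}\mu_\infty(s)\,d(s)$. *)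

theory Defs
  imports "HOL-Analysis.Analysis" "HOL-Probability.Probability"
begin

text \<open>A state (b_1..b_M, d; T, t) is encoded as (bs, d, T, t) with bs a list of length M,
  bs ! (m-1) = b_m.\<close>
type_synonym bdm_state = "int list \<times> int \<times> int \<times> nat"

definition bdm_S :: "nat \<Rightarrow> bdm_state set" where
  "bdm_S M = {(bs, d, T, t). length bs = M \<and> 1 \<le> t \<and> t \<le> M + 1 \<and>
                 d + T + sum_list bs = 0 \<and> 0 \<le> T \<and> T \<le> int M}"

definition bdm_S_Tt :: "nat \<Rightarrow> int \<Rightarrow> nat \<Rightarrow> bdm_state set" where
  "bdm_S_Tt M T0 t0 = {s \<in> bdm_S M. fst (snd (snd s)) = T0 \<and> snd (snd (snd s)) = t0}"

definition bdm_s0 :: "nat \<Rightarrow> bdm_state" where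
  "bdm_s0 M = (replicate M 0, 0, 0, M + 1)"

definition dcoord :: "bdm_state \<Rightarrow> int" where
  "dcoord s = fst (snd s)"

definition bdm_step :: "nat \<Rightarrow> nat \<Rightarrow> bdm_state \<Rightarrow> bdm_state pmf" where
  "bdm_step M q s = (case s of (bs, d, T, t) \<Rightarrow>
     if t \<le> M then
       (if bs ! (t - 1) > d then
          map_pmf (\<lambda>c. if c then (bs, d, T, t + 1)
                         else (bs[t - 1 := d], bs ! (t - 1), T, t + 1))
                  (bernoulli_pmf (1 / real q))
        else return_pmf (bs, d, T, t + 1))
     else if T < int M then return_pmf (bs, d - 1, T + 1, 1)
     else return_pmf (map (\<lambda>x. x + 1) bs, d, 0, 1))"

definition bdm_mu :: "nat \<Rightarrow> nat \<Rightarrow> nat \<Rightarrow> bdm_state pmf" where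
  "bdm_mu M q \<tau> = ((\<lambda>p. bind_pmf p (bdm_step M q)) ^^ \<tau>) (return_pmf (bdm_s0 M))"

definition bdm_mu_inf :: "nat \<Rightarrow> nat \<Rightarrow> bdm_state \<Rightarrow> real" where
  "bdm_mu_inf M q s = real_of_ereal (limsup (\<lambda>\<tau>. ereal (pmf (bdm_mu M q \<tau>) s)))"

definition dbar :: "nat \<Rightarrow> nat \<Rightarrow> int \<Rightarrow> nat \<Rightarrow> real" where
  "dbar M q T t = (\<Sum>\<^sub>\<infinity> s \<in> bdm_S_Tt M T t. bdm_mu_inf M q s * real_of_int (dcoord s))"

end

theory Submission
  imports Defs
begin

text \<open>Write \<open>psi\<close> for the sum of the squares of \<open>b\<^sub>1, \<dots>, b\<^sub>M, d\<close> minus \<open>T\<close>. The comparison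
  steps only permute these numbers, and each step at \<open>t = M + 1\<close> changes \<open>psi\<close> by exactly
  \<open>- 2 d\<close>. Hence, over a full cycle of \<open>M + 1\<close> sweeps, twice the sum of the expectations of
  \<open>d\<close> is the decrease of the expectation of \<open>psi\<close>, and this tends to 0 as soon as the chain
  observed once per cycle converges in a sense that includes the expectations of \<open>d\<close> and
  \<open>psi\<close>.

  The convergence is Harris' theorem. The Lyapunov function is an exponential energy plus a
  multiple of the gap between \<open>d\<close> and the largest value, which is closed with probability at least
  \<open>1 - 1/q\<close> in each sweep. The initial state is an atom reached from every sublevel set with
  a uniform probability: along the path where every possible swap happens, \<open>d\<close> is the largest
  value and so nonnegative after each sweep, so \<open>psi\<close> decreases by at least 2 in each cycle
  until all values vanish.\<close>

section \<open>Iterated kernels and Harris' theorem\<close>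

text \<open>The pair \<open>(T, t)\<close> moves deterministically with period (M + 1)^2, so
  \<open>bdm_mu\<close> itself need not converge: a given state can carry mass only at times in one
  residue class, and the limsup in \<open>bdm_mu_inf\<close> is the limit along that class.
  Pointwise limits do not suffice for \<open>dbar\<close>, which sums the unbounded function
  \<open>d\<close> against them; hence convergence in a weighted norm whose weight dominates both
  \<open>d\<close> and \<open>psi\<close>. \<open>psi\<close> cannot serve as the weight in a
  geometric drift argument: a sweep changes it by \<open>- 2 d\<close>, which is only of the order
  of the square root of the sum of squares, so no fixed fraction of a large \<open>psi\<close> is
  lost. With exponentials of the values, lowering the largest value by 1 does lose a fixed fraction
  of its term. The margin is thin, because charging \<open>d\<close> raises all other values
  relative to the mean; this dictates the constants below.\<close>

abbreviation expect :: "'a pmf \<Rightarrow> ('a \<Rightarrow> real) \<Rightarrow> real" where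
  "expect p f \<equiv> measure_pmf.expectation p f"

lemma expect_bind_finite:
  assumes "finite (set_pmf p)" "\<And>x. x \<in> set_pmf p \<Longrightarrow> finite (set_pmf (K x))"
  shows "expect (bind_pmf p K) f = expect p (\<lambda>x. expect (K x) f)"
proof -
  have "expect (bind_pmf p K) f = (\<Sum>x\<in>set_pmf p. pmf p x *\<^sub>R expect (K x) f)"
    using assms by (intro pmf_expectation_bind) auto
  also have "\<dots> = expect p (\<lambda>x. expect (K x) f)"
    using assms by (subst integral_measure_pmf[of "set_pmf p"]) auto
  finally show ?thesis .
qed

lemma expect_mono_finite:
  assumes "finite (set_pmf p)" "\<And>x. x \<in> set_pmf p \<Longrightarrow> f x \<le> g x"
  shows "expect p f \<le> expect p g"
  using assms by (intro integral_mono_AE) (auto simp: AE_measure_pmf_iff integrable_measure_pmf_finite)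

lemma expect_cong:
  assumes "\<And>x. x \<in> set_pmf p \<Longrightarrow> f x = g x"
  shows "expect p f = expect p g"
  using assms by (intro integral_cong_AE) (auto simp: AE_measure_pmf_iff)

lemma expect_affine:
  assumes "finite (set_pmf p)"
  shows "expect p (\<lambda>x. a * f x + b) = a * expect p f + b"
  using assms by (simp add: integrable_measure_pmf_finite)

lemma abs_expect_le:
  assumes "finite (set_pmf p)" "\<And>x. x \<in> set_pmf p \<Longrightarrow> \<bar>f x\<bar> \<le> g x"
  shows "\<bar>expect p f\<bar> \<le> expect p g"
proof -
  have "\<bar>expect p f\<bar> \<le> expect p (\<lambda>x. \<bar>f x\<bar>)" by (rule integral_abs_bound)
  also have "\<dots> \<le> expect p g" using assms by (rule expect_mono_finite)
  finally show ?thesis .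
qed

definition kernel_iter :: "('a \<Rightarrow> 'a pmf) \<Rightarrow> nat \<Rightarrow> 'a \<Rightarrow> 'a pmf" where
  "kernel_iter K n x = ((\<lambda>p. bind_pmf p K) ^^ n) (return_pmf x)"

lemma kernel_iter_0 [simp]: "kernel_iter K 0 x = return_pmf x"
  by (simp add: kernel_iter_def)

lemma kernel_iter_Suc: "kernel_iter K (Suc n) x = bind_pmf (kernel_iter K n x) K"
  by (simp add: kernel_iter_def)

lemma kernel_iter_1 [simp]: "kernel_iter K (Suc 0) x = K x"
  by (simp add: kernel_iter_Suc bind_return_pmf)

lemma kernel_iter_add: "kernel_iter K (m + n) x = bind_pmf (kernel_iter K m x) (kernel_iter K n)"
proof (induction n)
  case 0
  have "kernel_iter K 0 = return_pmf" by (auto simp: fun_eq_iff)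
  then show ?case by (simp add: bind_return_pmf')
next
  case (Suc n)
  have "kernel_iter K (Suc n) = (\<lambda>x. bind_pmf (kernel_iter K n x) K)"
    by (auto simp: fun_eq_iff kernel_iter_Suc)
  then show ?case using Suc by (simp add: kernel_iter_Suc bind_assoc_pmf)
qed

lemma kernel_iter_Suc': "kernel_iter K (Suc n) x = bind_pmf (K x) (kernel_iter K n)"
  using kernel_iter_add[of K 1 n x] by simp

text \<open>This changes the time scale: from steps to sweeps of \<open>M + 1\<close> steps, and
  from sweeps to cycles of \<open>M + 1\<close> sweeps.\<close>

lemma kernel_iter_mult: "kernel_iter K (m * n) x = kernel_iter (kernel_iter K m) n x"
proof (induction n)
  case (Suc n)
  have "kernel_iter K (m * Suc n) x = kernel_iter K (m * n + m) x" by (simp add: add.commute)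
  also have "\<dots> = bind_pmf (kernel_iter K (m * n) x) (kernel_iter K m)" by (rule kernel_iter_add)
  finally show ?case using Suc by (simp add: kernel_iter_Suc)
qed simp

text \<open>Only the paths through \<open>x\<close> are kept. Chained along one path, this bounds
  the probability of reaching its end from below.\<close>

lemma pmf_bind_ge:
  "pmf p x * pmf (K x) y \<le> pmf (bind_pmf p K) y"
proof -
  have "pmf p x * pmf (K x) y = expect p (\<lambda>z. indicator {x} z * pmf (K x) y)"
    by (simp add: pmf.rep_eq)
  also have "\<dots> \<le> expect p (\<lambda>z. pmf (K z) y)"
    by (intro integral_mono measure_pmf.integrable_const_bound[where B=1])
       (auto simp: indicator_def pmf_le_1 pmf_nonneg)
  finally show ?thesis by (simp add: pmf_bind)
qed

lemma pmf_map_ge: "pmf p x \<le> pmf (map_pmf f p) (f x)"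
  using pmf_bind_ge[of p x "\<lambda>x. return_pmf (f x)" "f x"] by (simp add: map_pmf_def)

lemma pmf_kernel_iter_add_ge:
  assumes "a \<le> pmf (kernel_iter K m x) y" "b \<le> pmf (kernel_iter K n y) z" "0 \<le> a" "0 \<le> b"
  shows "a * b \<le> pmf (kernel_iter K (m + n) x) z"
proof -
  have "a * b \<le> pmf (kernel_iter K m x) y * pmf (kernel_iter K n y) z"
    using assms by (intro mult_mono) auto
  also have "\<dots> \<le> pmf (kernel_iter K (m + n) x) z"
    unfolding kernel_iter_add by (rule pmf_bind_ge)
  finally show ?thesis .
qed

text \<open>\<open>A\<close> is a closed set of states. Finite supports make every real function
  integrable under each iterate started in \<open>A\<close>, including the unbounded ones used
  below.\<close>

locale finite_kernel =
  fixes K :: "'a \<Rightarrow> 'a pmf" and A :: "'a set"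
  assumes closed: "x \<in> A \<Longrightarrow> set_pmf (K x) \<subseteq> A"
    and fin: "x \<in> A \<Longrightarrow> finite (set_pmf (K x))"
begin

lemma kernel_iter_closed_fin:
  assumes "x \<in> A"
  shows "set_pmf (kernel_iter K n x) \<subseteq> A \<and> finite (set_pmf (kernel_iter K n x))"
  using assms
  by (induction n) (use closed fin in \<open>auto simp: kernel_iter_Suc\<close>)

lemma kernel_iter_closed: "x \<in> A \<Longrightarrow> set_pmf (kernel_iter K n x) \<subseteq> A"
  and kernel_iter_fin: "x \<in> A \<Longrightarrow> finite (set_pmf (kernel_iter K n x))"
  using kernel_iter_closed_fin by auto

lemma finite_kernel_iter: "finite_kernel (kernel_iter K n) A"
  using kernel_iter_closed kernel_iter_fin by unfold_locales auto

lemma expect_kernel_iter_add: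
  assumes "x \<in> A"
  shows "expect (kernel_iter K (m + n) x) f
       = expect (kernel_iter K m x) (\<lambda>y. expect (kernel_iter K n y) f)"
  unfolding kernel_iter_add
  using assms kernel_iter_closed kernel_iter_fin
  by (intro expect_bind_finite) blast+

lemma expect_kernel_iter_Suc:
  assumes "x \<in> A"
  shows "expect (kernel_iter K (Suc n) x) f = expect (kernel_iter K n x) (\<lambda>y. expect (K y) f)"
  using expect_kernel_iter_add[OF assms, of n 1 f] by simp

text \<open>The constants form a geometric series, whose sum \<open>C / (1 - g)\<close> serves all
  iterates at once.\<close>

lemma drift_kernel_iter:
  assumes drift: "\<And>x. x \<in> A \<Longrightarrow> expect (K x) V \<le> g * V x + C"
    and g: "0 \<le> g" "g < 1" and C: "0 \<le> C" and x: "x \<in> A"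
  shows "expect (kernel_iter K n x) V \<le> g ^ n * V x + C / (1 - g)"
proof (induction n)
  case 0
  show ?case using g C by simp
next
  case (Suc n)
  have "expect (kernel_iter K (Suc n) x) V = expect (kernel_iter K n x) (\<lambda>y. expect (K y) V)"
    by (rule expect_kernel_iter_Suc[OF x])
  also have "\<dots> \<le> expect (kernel_iter K n x) (\<lambda>y. g * V y + C)"
    using kernel_iter_closed[OF x] kernel_iter_fin[OF x] by (intro expect_mono_finite drift) auto
  also have "\<dots> = g * expect (kernel_iter K n x) V + C"
    using kernel_iter_fin[OF x] by (rule expect_affine)
  also have "\<dots> \<le> g * (g ^ n * V x + C / (1 - g)) + C"
    using Suc g by (intro add_right_mono mult_left_mono) auto
  also have "\<dots> = g ^ Suc n * V x + C / (1 - g)"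
    using g by (simp add: field_simps)
  finally show ?case .
qed

text \<open>One step of Harris' theorem after Hairer and Mattingly. Running two copies independently
  suffices: from the sublevel set both sit at the atom \<open>a\<close> with probability at least
  \<open>\<alpha>\<^sup>2\<close>, and there the test function difference vanishes.\<close>

lemma harris_contraction:
  assumes drift: "\<And>x. x \<in> A \<Longrightarrow> expect (K x) V \<le> g * V x + C"
    and V: "\<And>x. x \<in> A \<Longrightarrow> 0 \<le> V x"
    and g: "0 \<le> g" "g < 1" and C: "0 \<le> C"
    and R: "0 < R" "4 * C \<le> (1 - g) * R"
    and atom: "\<And>x. x \<in> A \<Longrightarrow> V x \<le> R \<Longrightarrow> \<alpha> \<le> pmf (K x) a" and \<alpha>: "0 < \<alpha>"
  obtains \<beta> r where "0 < \<beta>" "0 < r" "r < 1"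
    "\<And>f x y. (\<And>x y. x \<in> A \<Longrightarrow> y \<in> A \<Longrightarrow> \<bar>f x - f y\<bar> \<le> 2 + \<beta> * V x + \<beta> * V y) \<Longrightarrow>
       x \<in> A \<Longrightarrow> y \<in> A \<Longrightarrow> \<bar>expect (K x) f - expect (K y) f\<bar> \<le> r * (2 + \<beta> * V x + \<beta> * V y)"
proof -
  define \<delta> where "\<delta> = (min \<alpha> 1)\<^sup>2"
  \<comment> \<open>Sized so that the drift constants of the two copies,
    \<open>2 * \<beta> * C\<close>, use up at most half of the \<open>2 * \<delta>\<close> gained at
    the atom.\<close>
  define \<beta> where "\<beta> = \<delta> / (2 * C + 1)"
  have \<delta>: "0 < \<delta>" "\<delta> \<le> 1" "\<delta> \<le> \<alpha>\<^sup>2"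
    using \<alpha> by (auto simp: \<delta>_def power_le_one intro!: power_mono)
  have \<beta>: "0 < \<beta>" "2 * \<beta> * C \<le> \<delta>"
    using \<delta> C by (auto simp: \<beta>_def field_simps)
  \<comment> \<open>Far out, where \<open>S = V x + V y\<close> is at least \<open>R\<close>, the
    drift constant is absorbed by replacing \<open>g\<close> with \<open>(1 + g) / 2\<close>. The
    quotient of the new distance by the old one then decreases in \<open>S\<close>, and
    \<open>r1\<close> is its value at \<open>S = R\<close>.\<close>
  define r1 where "r1 = (2 + \<beta> * ((1 + g) / 2) * R) / (2 + \<beta> * R)"
  define r where "r = max r1 (max (1 - \<delta> / 2) g)"
  have bR: "0 < \<beta> * R" using \<beta> R by simp
  have r1: "r1 < 1"
  proof -
    have "\<beta> * R * ((1 + g) / 2) < \<beta> * R * 1"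
      using bR g by (intro mult_strict_left_mono) auto
    then have "\<beta> * ((1 + g) / 2) * R < \<beta> * R" by (simp add: mult_ac)
    then show ?thesis using bR by (simp add: r1_def)
  qed
  have r: "0 < r" "r < 1" using g \<delta> r1 by (auto simp: r_def)
  have main: "\<bar>expect (K x) f - expect (K y) f\<bar> \<le> r * (2 + \<beta> * V x + \<beta> * V y)"
    if f: "\<And>x y. x \<in> A \<Longrightarrow> y \<in> A \<Longrightarrow> \<bar>f x - f y\<bar> \<le> 2 + \<beta> * V x + \<beta> * V y"
      and x: "x \<in> A" and y: "y \<in> A" for f x y
  proof -
    let ?P = "pair_pmf (K x) (K y)"
    define h where "h = (\<lambda>z. 2 + \<beta> * V (fst z) + \<beta> * V (snd z))"
    define p where "p = pmf (K x) a * pmf (K y) a"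
    have finP: "finite (set_pmf ?P)" using fin x y by simp
    have int: "integrable (measure_pmf ?P) u" for u :: "_ \<Rightarrow> real"
      using finP by (rule integrable_measure_pmf_finite)
    have inA: "fst z \<in> A" "snd z \<in> A" if "z \<in> set_pmf ?P" for z
      using that closed[OF x] closed[OF y] by auto
    have "expect (K x) f - expect (K y) f = expect ?P (\<lambda>z. f (fst z) - f (snd z))"
      using int by simp
    also have "\<bar>\<dots>\<bar> \<le> expect ?P (\<lambda>z. h z - 2 * indicator {(a, a)} z)"
    proof (rule abs_expect_le[OF finP])
      fix z assume z: "z \<in> set_pmf ?P"
      then show "\<bar>f (fst z) - f (snd z)\<bar> \<le> h z - 2 * indicator {(a, a)} z"
        using f[OF inA[OF z]] V[OF inA(1)[OF z]] V[OF inA(2)[OF z]] \<beta>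
        by (cases "z = (a, a)") (auto simp: h_def)
    qed
    also have "\<dots> = 2 + \<beta> * expect (K x) V + \<beta> * expect (K y) V - 2 * p"
      using int by (simp add: h_def p_def measure_pmf_single pmf_pair)
    also have "\<dots> \<le> 2 + \<beta> * (g * V x + C) + \<beta> * (g * V y + C) - 2 * p"
      using drift[OF x] drift[OF y] \<beta> by (intro diff_mono add_mono mult_left_mono) auto
    finally have bound: "\<bar>expect (K x) f - expect (K y) f\<bar>
        \<le> 2 + \<beta> * g * (V x + V y) + 2 * \<beta> * C - 2 * p"
      by (simp add: algebra_simps)
    define S where "S = V x + V y"
    have S0: "0 \<le> S" using V x y by (simp add: S_def)
    have p0: "0 \<le> p" by (simp add: p_def)
    have goal: "\<bar>expect (K x) f - expect (K y) f\<bar> \<le> r * (2 + \<beta> * S)"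
    proof (cases "R \<le> S")
      case True
      have "(1 - g) * R \<le> (1 - g) * S" using True g by (intro mult_left_mono) auto
      then have "2 * C \<le> (1 - g) / 2 * S" using R by simp
      then have "\<beta> * (2 * C) \<le> \<beta> * ((1 - g) / 2 * S)"
        using \<beta> by (intro mult_left_mono) auto
      moreover have "\<beta> * ((1 - g) / 2 * S) = \<beta> * ((1 + g) / 2) * S - \<beta> * g * S"
        by (simp add: field_simps)
      ultimately have "2 + \<beta> * g * S + 2 * \<beta> * C - 2 * p \<le> 2 + \<beta> * ((1 + g) / 2) * S"
        using p0 by linarith
      also have "\<dots> \<le> r1 * (2 + \<beta> * S)"
      proof -
        have "0 \<le> \<beta> * (1 - (1 + g) / 2) * (S - R)"
          using True \<beta> g by (intro mult_nonneg_nonneg) auto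
        moreover have "(2 + \<beta> * c * R) * (2 + \<beta> * S) - (2 + \<beta> * c * S) * (2 + \<beta> * R)
            = 2 * (\<beta> * (1 - c) * (S - R))" for c
          by (simp add: algebra_simps)
        ultimately have "(2 + \<beta> * ((1 + g) / 2) * S) * (2 + \<beta> * R)
            \<le> (2 + \<beta> * ((1 + g) / 2) * R) * (2 + \<beta> * S)"
          by (metis diff_ge_0_iff_ge zero_le_mult_iff zero_le_numeral)
        then show ?thesis using bR by (simp add: r1_def pos_le_divide_eq)
      qed
      also have "\<dots> \<le> r * (2 + \<beta> * S)"
        using S0 \<beta> by (intro mult_right_mono) (auto simp: r_def)
      finally show ?thesis using bound by (simp add: S_def)
    next
      case False
      then have "V x \<le> R" "V y \<le> R" using V[OF x] V[OF y] by (auto simp: S_def)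
      then have "\<alpha> * \<alpha> \<le> p" unfolding p_def using atom x y \<alpha>
        by (intro mult_mono) auto
      then have "\<delta> \<le> p" using \<delta> by (simp add: power2_eq_square)
      then have "2 + \<beta> * g * S + 2 * \<beta> * C - 2 * p \<le> (1 - \<delta> / 2) * 2 + g * (\<beta> * S)"
        using \<beta> by (simp add: algebra_simps)
      also have "\<dots> \<le> r * 2 + r * (\<beta> * S)"
        using S0 \<beta> by (intro add_mono mult_right_mono) (auto simp: r_def)
      finally show ?thesis using bound by (simp add: S_def algebra_simps)
    qed
    then show ?thesis by (simp add: S_def algebra_simps)
  qed
  show thesis by (rule that[OF \<beta>(1) r main])
qed

text \<open>With \<open>D\<close> read as a distance, the hypothesis says that the kernel maps
  1-Lipschitz functions to r-Lipschitz ones. The n-step expectation divided by \<open>r ^ n\<close>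
  is again 1-Lipschitz, so the hypothesis applies to it.\<close>

lemma contraction_iterate:
  assumes contr: "\<And>f x y. (\<And>x y. x \<in> A \<Longrightarrow> y \<in> A \<Longrightarrow> \<bar>f x - f y\<bar> \<le> D x y) \<Longrightarrow>
       x \<in> A \<Longrightarrow> y \<in> A \<Longrightarrow> \<bar>expect (K x) f - expect (K y) f\<bar> \<le> r * D x y"
    and r: "0 < (r :: real)"
    and f: "\<And>x y. x \<in> A \<Longrightarrow> y \<in> A \<Longrightarrow> \<bar>f x - f y\<bar> \<le> D x y"
    and xy: "x \<in> A" "y \<in> A"
  shows "\<bar>expect (kernel_iter K n x) f - expect (kernel_iter K n y) f\<bar> \<le> r ^ n * D x y"
  using xy
proof (induction n arbitrary: x y)
  case 0
  then show ?case using f by simp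
next
  case (Suc n)
  define c where "c = r ^ n"
  have c: "0 < c" using r by (simp add: c_def)
  have e: "expect (kernel_iter K (Suc n) z) f = c * expect (K z) (\<lambda>u. expect (kernel_iter K n u) f / c)"
    if "z \<in> A" for z
  proof -
    have "expect (kernel_iter K (Suc n) z) f = expect (K z) (\<lambda>u. expect (kernel_iter K n u) f)"
      using expect_kernel_iter_add[OF that, of 1 n f] by simp
    also have "\<dots> = expect (K z) (\<lambda>u. c * (expect (kernel_iter K n u) f / c))"
      using c by simp
    finally show ?thesis by (simp only: integral_mult_right_zero)
  qed
  have "\<bar>expect (kernel_iter K n u) f / c - expect (kernel_iter K n v) f / c\<bar> \<le> D u v"
    if "u \<in> A" "v \<in> A" for u v
  proof -
    have "\<bar>expect (kernel_iter K n u) f / c - expect (kernel_iter K n v) f / c\<bar>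
        = \<bar>expect (kernel_iter K n u) f - expect (kernel_iter K n v) f\<bar> / c"
      using c by (simp add: diff_divide_distrib[symmetric])
    also have "\<dots> \<le> D u v"
      using Suc.IH[OF that] c by (simp add: pos_divide_le_eq mult.commute c_def)
    finally show ?thesis .
  qed
  then have "\<bar>expect (K x) (\<lambda>u. expect (kernel_iter K n u) f / c)
       - expect (K y) (\<lambda>u. expect (kernel_iter K n u) f / c)\<bar> \<le> r * D x y"
    using Suc.prems by (intro contr) auto
  then have "c * \<bar>expect (K x) (\<lambda>u. expect (kernel_iter K n u) f / c)
       - expect (K y) (\<lambda>u. expect (kernel_iter K n u) f / c)\<bar> \<le> c * (r * D x y)"
    using c by (intro mult_left_mono) auto
  moreover have "\<bar>c * a - c * b\<bar> = c * \<bar>a - b\<bar>" for a b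
    using c by (simp add: right_diff_distrib[symmetric] abs_mult)
  moreover have "c * (r * D x y) = r ^ Suc n * D x y" by (simp add: c_def)
  ultimately show ?case
    unfolding e[OF Suc.prems(1)] e[OF Suc.prems(2)] by metis
qed

text \<open>This is the Cauchy property in the total variation norm weighted by \<open>V\<close>.
  Late laws are images of earlier ones under \<open>n * k\<close> steps, and the drift bounds the
  expectation of \<open>V\<close> under the earlier ones, so the contraction brings all late laws
  together. In \<open>atom\<close>, \<open>n\<close> may depend on \<open>R\<close>, since the way
  to the atom gets longer from higher sublevel sets.\<close>

theorem harris_uniformly_Cauchy:
  assumes drift: "\<And>x. x \<in> A \<Longrightarrow> expect (K x) V \<le> g * V x + C"
    and V: "\<And>x. x \<in> A \<Longrightarrow> 0 \<le> V x"
    and g: "0 \<le> g" "g < 1" and C: "0 \<le> C"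
    and atom: "\<And>R. \<exists>n \<alpha>. 0 < n \<and> 0 < \<alpha> \<and> (\<forall>x\<in>A. V x \<le> R \<longrightarrow> \<alpha> \<le> pmf (kernel_iter K n x) a)"
    and x0: "x0 \<in> A" and e: "0 < e"
  shows "\<exists>n0. \<forall>i\<ge>n0. \<forall>j\<ge>n0. \<forall>f. (\<forall>x\<in>A. \<bar>f x\<bar> \<le> V x) \<longrightarrow>
      \<bar>expect (kernel_iter K i x0) f - expect (kernel_iter K j x0) f\<bar> \<le> e"
proof -
  \<comment> \<open>A drift constant valid for every iterate, so that \<open>R\<close> can be fixed
    before \<open>atom\<close> supplies \<open>n\<close>.\<close>
  define C' where "C' = C / (1 - g)"
  have C': "0 \<le> C'" using C g by (simp add: C'_def)
  have V_iter: "expect (kernel_iter K n x) V \<le> g ^ n * V x + C'" if "x \<in> A" for n x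
    unfolding C'_def using drift_kernel_iter[OF drift g C that] .
  define R where "R = 4 * C' / (1 - g) + 1"
  have R: "0 < R" "4 * C' \<le> (1 - g) * R"
    using C' g by (auto simp: R_def distrib_left intro!: add_nonneg_pos)
  obtain n \<alpha> where n: "0 < n" and \<alpha>: "0 < \<alpha>"
    and at: "\<And>x. x \<in> A \<Longrightarrow> V x \<le> R \<Longrightarrow> \<alpha> \<le> pmf (kernel_iter K n x) a"
    using atom[of R] by blast
  interpret Q: finite_kernel "kernel_iter K n" A by (rule finite_kernel_iter)
  have driftQ: "expect (kernel_iter K n x) V \<le> g * V x + C'" if "x \<in> A" for x
  proof -
    have "g ^ n \<le> g ^ 1" using n g by (intro power_decreasing) auto
    then have "g ^ n * V x \<le> g * V x" using V[OF that] by (intro mult_right_mono) auto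
    then show ?thesis using V_iter[OF that, of n] by simp
  qed
  obtain \<beta> r where \<beta>: "0 < \<beta>" and r: "0 < r" "r < 1" and contr:
    "\<And>f x y. (\<And>x y. x \<in> A \<Longrightarrow> y \<in> A \<Longrightarrow> \<bar>f x - f y\<bar> \<le> 2 + \<beta> * V x + \<beta> * V y) \<Longrightarrow>
       x \<in> A \<Longrightarrow> y \<in> A \<Longrightarrow> \<bar>expect (kernel_iter K n x) f - expect (kernel_iter K n y) f\<bar>
          \<le> r * (2 + \<beta> * V x + \<beta> * V y)"
    using Q.harris_contraction[OF driftQ V g C' R at \<alpha>] by blast
  define B where "B = 2 + 2 * \<beta> * V x0 + \<beta> * C'"
  have B: "0 < B" using V[OF x0] C' \<beta> by (simp add: B_def add_pos_nonneg)
  have close: "\<beta> * \<bar>expect (kernel_iter K i x0) f - expect (kernel_iter K (n * k) x0) f\<bar> \<le> r ^ k * B"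
    if f: "\<forall>x\<in>A. \<bar>f x\<bar> \<le> V x" and i: "n * k \<le> i" for f i k
  proof -
    obtain m where m: "i = m + n * k" using i by (metis add.commute le_Suc_ex)
    let ?Q = "\<lambda>u. expect (kernel_iter (kernel_iter K n) k u) (\<lambda>v. \<beta> * f v)"
    let ?p = "kernel_iter K m x0"
    have fin: "finite (set_pmf ?p)" and cl: "set_pmf ?p \<subseteq> A"
      using kernel_iter_fin kernel_iter_closed x0 by auto
    have Lip: "\<bar>\<beta> * f u - \<beta> * f v\<bar> \<le> 2 + \<beta> * V u + \<beta> * V v" if "u \<in> A" "v \<in> A" for u v
    proof -
      have "\<bar>f u - f v\<bar> \<le> V u + V v"
        using bspec[OF f that(1)] bspec[OF f that(2)] by linarith
      then have "\<beta> * \<bar>f u - f v\<bar> \<le> \<beta> * (V u + V v)" using \<beta> by (intro mult_left_mono) auto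
      moreover have "\<bar>\<beta> * f u - \<beta> * f v\<bar> = \<beta> * \<bar>f u - f v\<bar>"
        using \<beta> by (simp add: right_diff_distrib[symmetric] abs_mult)
      ultimately show ?thesis by (simp add: algebra_simps)
    qed
    have it: "\<bar>?Q u - ?Q x0\<bar> \<le> r ^ k * (2 + \<beta> * V u + \<beta> * V x0)" if "u \<in> A" for u
      by (rule Q.contraction_iterate[OF contr r(1) Lip that x0])
    have "\<beta> * expect (kernel_iter K i x0) f = expect ?p ?Q"
      using expect_kernel_iter_add[OF x0, of m "n * k" f] by (simp add: m kernel_iter_mult[of K n k])
    then have "\<beta> * (expect (kernel_iter K i x0) f - expect (kernel_iter K (n * k) x0) f)
        = expect ?p ?Q - ?Q x0"
      by (simp add: kernel_iter_mult[of K n k] right_diff_distrib)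
    also have "\<dots> = expect ?p (\<lambda>u. ?Q u - ?Q x0)"
      using fin by (simp add: integrable_measure_pmf_finite)
    also have "\<bar>\<dots>\<bar> \<le> expect ?p (\<lambda>u. (r ^ k * \<beta>) * V u + r ^ k * (2 + \<beta> * V x0))"
      using cl it by (intro abs_expect_le[OF fin]) (force simp: algebra_simps)
    also have "\<dots> = r ^ k * \<beta> * expect ?p V + r ^ k * (2 + \<beta> * V x0)"
      by (rule expect_affine[OF fin])
    also have "\<dots> \<le> r ^ k * \<beta> * (V x0 + C') + r ^ k * (2 + \<beta> * V x0)"
    proof (intro add_right_mono mult_left_mono)
      have "g ^ m * V x0 \<le> 1 * V x0"
        using V[OF x0] g by (intro mult_right_mono power_le_one) auto
      then show "expect ?p V \<le> V x0 + C'" using V_iter[OF x0, of m] by simp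
    qed (use r \<beta> in auto)
    also have "\<dots> = r ^ k * B" by (simp add: B_def algebra_simps)
    finally show ?thesis using \<beta> by (simp add: abs_mult)
  qed
  have "0 < e * \<beta> / (2 * B)" using e \<beta> B by simp
  then obtain k where "r ^ k < e * \<beta> / (2 * B)"
    using real_arch_pow_inv[OF _ r(2)] by blast
  then have k: "r ^ k * B * 2 < \<beta> * e" using B by (simp add: field_simps)
  show ?thesis
  proof (intro exI[of _ "n * k"] allI impI)
    fix i j f assume ij: "n * k \<le> i" "n * k \<le> j" and f: "\<forall>x\<in>A. \<bar>f x\<bar> \<le> V x"
    let ?E = "\<lambda>i. expect (kernel_iter K i x0) f"
    have "\<beta> * \<bar>?E i - ?E j\<bar> \<le> \<beta> * (\<bar>?E i - ?E (n * k)\<bar> + \<bar>?E j - ?E (n * k)\<bar>)"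
      using \<beta> by (intro mult_left_mono) auto
    also have "\<dots> \<le> \<beta> * e"
      using close[OF f ij(1)] close[OF f ij(2)] k by (simp add: algebra_simps)
    finally show "\<bar>?E i - ?E j\<bar> \<le> e" using \<beta> by simp
  qed
qed

end

section \<open>Limits of laws in a weighted l1 norm, and limsups along a subsequence\<close>

lemma weighted_l1_limit:
  fixes W :: "'a \<Rightarrow> real" and p :: "nat \<Rightarrow> 'a pmf"
  assumes fin: "\<And>n. finite (set_pmf (p n))"
    and sub: "\<And>n. set_pmf (p n) \<subseteq> A" and W: "\<And>x. x \<in> A \<Longrightarrow> 1 \<le> W x"
    and Cauchy: "\<And>e. 0 < e \<Longrightarrow> \<exists>n0. \<forall>i\<ge>n0. \<forall>j\<ge>n0. \<forall>f. (\<forall>x\<in>A. \<bar>f x\<bar> \<le> W x) \<longrightarrow>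
      \<bar>expect (p i) f - expect (p j) f\<bar> \<le> e"
  obtains m where "\<And>x. (\<lambda>n. pmf (p n) x) \<longlonglongrightarrow> m x"
    "\<And>f. (\<And>x. x \<in> A \<Longrightarrow> \<bar>f x\<bar> \<le> W x) \<Longrightarrow> (\<lambda>x. m x * f x) summable_on A"
    "\<And>f. (\<And>x. x \<in> A \<Longrightarrow> \<bar>f x\<bar> \<le> W x) \<Longrightarrow> (\<lambda>n. expect (p n) f) \<longlonglongrightarrow> (\<Sum>\<^sub>\<infinity>x\<in>A. m x * f x)"
proof -
  have E_sum: "expect (p n) f = (\<Sum>x\<in>F. pmf (p n) x * f x)"
    if "finite F" "\<And>x. x \<in> A \<Longrightarrow> x \<notin> F \<Longrightarrow> f x = 0" for n f F
    using that sub[of n] by (subst integral_measure_pmf[of F]) auto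
  have "convergent (\<lambda>n. pmf (p n) x)" for x
  proof (rule Cauchy_convergent, unfold Cauchy_def, intro allI impI)
    fix e :: real assume "0 < e"
    then have "0 < e / 2" by simp
    from Cauchy[OF this] obtain n0 where n0: "\<And>i j f. i \<ge> n0 \<Longrightarrow> j \<ge> n0 \<Longrightarrow> (\<forall>x\<in>A. \<bar>f x\<bar> \<le> W x) \<Longrightarrow>
        \<bar>expect (p i) f - expect (p j) f\<bar> \<le> e / 2"
      by blast
    \<comment> \<open>Since \<open>1 \<le> W\<close>, indicators of points are admissible test
      functions; they yield the pointwise limits.\<close>
    have "\<forall>z\<in>A. \<bar>indicator {x} z\<bar> \<le> W z"
      using W by (force simp: indicator_def)
    from n0[OF _ _ this]
    have "dist (pmf (p i) x) (pmf (p j) x) < e" if "i \<ge> n0" "j \<ge> n0" for i j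
      using that \<open>0 < e\<close> by (force simp: dist_real_def pmf.rep_eq)
    then show "\<exists>M. \<forall>m\<ge>M. \<forall>n\<ge>M. dist (pmf (p m) x) (pmf (p n) x) < e" by blast
  qed
  then obtain m where m: "\<And>x. (\<lambda>n. pmf (p n) x) \<longlonglongrightarrow> m x"
    unfolding convergent_def by metis
  \<comment> \<open>Over a finite set the limit in \<open>j\<close> can be taken termwise. The bound
    does not depend on \<open>F\<close>, so it passes to all of \<open>A\<close> afterwards.\<close>
  have tail: "\<exists>n0. \<forall>i\<ge>n0. \<forall>F. finite F \<and> F \<subseteq> A \<longrightarrow> (\<Sum>x\<in>F. \<bar>pmf (p i) x - m x\<bar> * W x) \<le> e"
    if e: "0 < e" for e
  proof -
    obtain n0 where n0: "\<And>i j f. i \<ge> n0 \<Longrightarrow> j \<ge> n0 \<Longrightarrow> (\<forall>x\<in>A. \<bar>f x\<bar> \<le> W x) \<Longrightarrow>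
        \<bar>expect (p i) f - expect (p j) f\<bar> \<le> e"
      using Cauchy[OF e] by blast
    have "(\<Sum>x\<in>F. \<bar>pmf (p i) x - m x\<bar> * W x) \<le> e"
      if i: "i \<ge> n0" and F: "finite F" "F \<subseteq> A" for i F
    proof (rule tendsto_upperbound)
      show "(\<lambda>j. \<Sum>x\<in>F. \<bar>pmf (p i) x - pmf (p j) x\<bar> * W x)
          \<longlonglongrightarrow> (\<Sum>x\<in>F. \<bar>pmf (p i) x - m x\<bar> * W x)"
        by (intro tendsto_intros m)
      show "\<forall>\<^sub>F j in sequentially. (\<Sum>x\<in>F. \<bar>pmf (p i) x - pmf (p j) x\<bar> * W x) \<le> e"
        unfolding eventually_sequentially
      proof (intro exI allI impI)
        fix j assume j: "n0 \<le> j"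
        \<comment> \<open>Weighted signs turn the l1 distance over \<open>F\<close> into a
          difference of two expectations.\<close>
        define f where "f = (\<lambda>x. if x \<in> F then sgn (pmf (p i) x - pmf (p j) x) * W x else 0)"
        have f: "\<forall>x\<in>A. \<bar>f x\<bar> \<le> W x" using W by (force simp: f_def abs_mult sgn_if)
        have "(\<Sum>x\<in>F. \<bar>pmf (p i) x - pmf (p j) x\<bar> * W x)
            = (\<Sum>x\<in>F. pmf (p i) x * f x - pmf (p j) x * f x)"
          by (intro sum.cong) (auto simp: f_def sgn_if algebra_simps)
        also have "\<dots> = expect (p i) f - expect (p j) f"
          using F by (simp add: E_sum[of F] f_def sum_subtractf)
        also have "\<dots> \<le> e" using n0[OF i j f] by simp
        finally show "(\<Sum>x\<in>F. \<bar>pmf (p i) x - pmf (p j) x\<bar> * W x) \<le> e" .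
      qed
    qed simp
    then show ?thesis by blast
  qed
  have diff: "\<exists>n0. \<forall>i\<ge>n0. (\<lambda>x. \<bar>pmf (p i) x - m x\<bar> * W x) summable_on A
      \<and> (\<Sum>\<^sub>\<infinity>x\<in>A. \<bar>pmf (p i) x - m x\<bar> * W x) \<le> e" if e: "0 < e" for e
  proof -
    obtain n0 where n0: "\<And>i F. i \<ge> n0 \<Longrightarrow> finite F \<Longrightarrow> F \<subseteq> A \<Longrightarrow>
        (\<Sum>x\<in>F. \<bar>pmf (p i) x - m x\<bar> * W x) \<le> e"
      using tail[OF e] by blast
    have nn: "0 \<le> \<bar>pmf (p i) x - m x\<bar> * W x" if "x \<in> A" for i x
      using W[OF that] by auto
    have s: "(\<lambda>x. \<bar>pmf (p i) x - m x\<bar> * W x) summable_on A" if "i \<ge> n0" for i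
      using n0[OF that] nn by (intro nonneg_bdd_above_summable_on bdd_aboveI2[where M=e]) auto
    moreover have "(\<Sum>\<^sub>\<infinity>x\<in>A. \<bar>pmf (p i) x - m x\<bar> * W x) \<le> e" if "i \<ge> n0" for i
      using s[OF that] n0[OF that] by (intro infsum_le_finite_sums) auto
    ultimately show ?thesis by blast
  qed
  have fs: "((\<lambda>x. pmf (p n) x * f x) has_sum expect (p n) f) A" for n f
  proof -
    have "expect (p n) f = (\<Sum>x\<in>set_pmf (p n). pmf (p n) x * f x)"
      using fin[of n] by (subst integral_measure_pmf[of "set_pmf (p n)"]) auto
    then have "((\<lambda>x. pmf (p n) x * f x) has_sum expect (p n) f) (set_pmf (p n))"
      using has_sum_finite[OF fin[of n]] by metis
    then show ?thesis
      by (rule has_sum_cong_neutral[THEN iffD1, rotated -1]) 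
         (use sub[of n] in \<open>auto simp: set_pmf_iff\<close>)
  qed
  have close: "\<exists>n0. \<forall>i\<ge>n0. (\<lambda>x. m x * f x) summable_on A
      \<and> \<bar>expect (p i) f - (\<Sum>\<^sub>\<infinity>x\<in>A. m x * f x)\<bar> \<le> e"
    if f: "\<And>x. x \<in> A \<Longrightarrow> \<bar>f x\<bar> \<le> W x" and e: "0 < e" for f e
  proof -
    obtain n0 where n0: "\<And>i. i \<ge> n0 \<Longrightarrow> (\<lambda>x. \<bar>pmf (p i) x - m x\<bar> * W x) summable_on A"
      "\<And>i. i \<ge> n0 \<Longrightarrow> (\<Sum>\<^sub>\<infinity>x\<in>A. \<bar>pmf (p i) x - m x\<bar> * W x) \<le> e"
      using diff[OF e] by blast
    have "(\<lambda>x. m x * f x) summable_on A \<and> \<bar>expect (p i) f - (\<Sum>\<^sub>\<infinity>x\<in>A. m x * f x)\<bar> \<le> e"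
      if i: "i \<ge> n0" for i
    proof -
      \<comment> \<open>\<open>m\<close> is the finitely supported law \<open>p i\<close> plus a
        difference whose weighted sum is at most \<open>e\<close>; both parts are summable against
        \<open>f\<close>.\<close>
      let ?u = "\<lambda>x. (m x - pmf (p i) x) * f x"
      have le: "norm (?u x) \<le> \<bar>pmf (p i) x - m x\<bar> * W x" if "x \<in> A" for x
        using f[OF that] by (auto simp: abs_mult abs_minus_commute intro!: mult_left_mono)
      have abs: "(\<lambda>x. norm (?u x)) summable_on A"
        using n0(1)[OF i] le by (rule summable_on_comparison_test) auto
      then have u: "?u summable_on A" by (rule abs_summable_summable)
      have "((\<lambda>x. pmf (p i) x * f x + ?u x) has_sum expect (p i) f + infsum ?u A) A"
        using fs has_sum_infsum[OF u] by (rule has_sum_add)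
      then have mf: "((\<lambda>x. m x * f x) has_sum expect (p i) f + infsum ?u A) A"
        by (simp add: algebra_simps)
      have "\<bar>infsum ?u A\<bar> \<le> infsum (\<lambda>x. norm (?u x)) A"
        using norm_infsum_bound[OF abs] by simp
      also have "\<dots> \<le> (\<Sum>\<^sub>\<infinity>x\<in>A. \<bar>pmf (p i) x - m x\<bar> * W x)"
        using abs n0(1)[OF i] le by (rule infsum_mono)
      also have "\<dots> \<le> e" using n0(2)[OF i] .
      finally show ?thesis using mf infsumI[OF mf] by (auto simp: summable_on_def)
    qed
    then show ?thesis by blast
  qed
  show thesis
  proof (rule that[OF m])
    show "(\<lambda>x. m x * f x) summable_on A" if "\<And>x. x \<in> A \<Longrightarrow> \<bar>f x\<bar> \<le> W x" for f
      using close[OF that, of 1] by auto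
    show "(\<lambda>n. expect (p n) f) \<longlonglongrightarrow> (\<Sum>\<^sub>\<infinity>x\<in>A. m x * f x)"
      if f: "\<And>x. x \<in> A \<Longrightarrow> \<bar>f x\<bar> \<le> W x" for f
    proof (rule LIMSEQ_I)
      fix e :: real assume "0 < e"
      then obtain n0 where "\<forall>i\<ge>n0. \<bar>expect (p i) f - (\<Sum>\<^sub>\<infinity>x\<in>A. m x * f x)\<bar> \<le> e / 2"
        using close[OF f, of "e / 2"] half_gt_zero by blast
      then show "\<exists>n0. \<forall>n\<ge>n0. norm (expect (p n) f - (\<Sum>\<^sub>\<infinity>x\<in>A. m x * f x)) < e"
        using \<open>0 < e\<close> by (intro exI[of _ n0]) force
    qed
  qed
qed

text \<open>The values off the range of \<open>g\<close> are 0 and cannot exceed \<open>L\<close>,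
  which is nonnegative, so the limsup is decided along \<open>g\<close>.\<close>

lemma limsup_along_subsequence:
  fixes f :: "nat \<Rightarrow> real"
  assumes g: "strict_mono g" and lim: "(\<lambda>n. f (g n)) \<longlonglongrightarrow> L"
    and zero: "\<And>n. n \<notin> range g \<Longrightarrow> f n = 0" and nonneg: "\<And>n. 0 \<le> f n"
  shows "limsup (\<lambda>n. ereal (f n)) = ereal L"
proof (rule antisym)
  have L: "0 \<le> L" using lim nonneg by (intro LIMSEQ_le_const[OF lim]) auto
  show "limsup (\<lambda>n. ereal (f n)) \<le> ereal L"
  proof (rule ereal_le_epsilon2)
    fix e :: real assume e: "0 < e"
    have "\<forall>\<^sub>F n in sequentially. f (g n) < L + e"
      using order_tendstoD(2)[OF lim] e by simp
    then obtain N where N: "\<And>n. N \<le> n \<Longrightarrow> f (g n) < L + e"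
      by (auto simp: eventually_sequentially)
    have "ereal (f n) \<le> ereal L + ereal e" if "g N \<le> n" for n
    proof (cases "n \<in> range g")
      case True
      then obtain k where k: "n = g k" by blast
      then have "N \<le> k" using that g by (simp add: strict_mono_less_eq)
      then show ?thesis using N[of k] k by simp
    qed (use zero L e in simp)
    then show "limsup (\<lambda>n. ereal (f n)) \<le> ereal L + ereal e"
      by (intro Limsup_bounded) (auto simp: eventually_sequentially)
  qed
  have "((\<lambda>n. ereal (f n)) \<circ> g) \<longlonglongrightarrow> ereal L" using lim by (simp add: comp_def)
  then have "limsup ((\<lambda>n. ereal (f n)) \<circ> g) = ereal L"
    by (intro lim_imp_Limsup) auto
  then show "ereal L \<le> limsup (\<lambda>n. ereal (f n))"
    using limsup_subseq_mono[OF g, of "\<lambda>n. ereal (f n)"] by simp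
qed

section \<open>Sweeps of the battery discharge model\<close>

lemma sum_mset_image_le:
  fixes f :: "'a \<Rightarrow> 'b :: linordered_idom"
  assumes "\<And>x. x \<in># X \<Longrightarrow> f x \<le> c"
  shows "(\<Sum>x\<in>#X. f x) \<le> of_nat (size X) * c"
  using assms by (induction X) (auto simp: algebra_simps intro!: add_mono)

lemma sum_mset_image_ge:
  fixes f :: "'a \<Rightarrow> 'b :: linordered_idom"
  assumes "\<And>x. x \<in># X \<Longrightarrow> c \<le> f x"
  shows "of_nat (size X) * c \<le> (\<Sum>x\<in>#X. f x)"
  using assms by (induction X) (auto simp: algebra_simps intro!: add_mono)

lemma of_int_sum_mset: "of_int (\<Sum>x\<in>#X. f x) = (\<Sum>x\<in>#X. of_int (f x) :: real)"
  by (induction X) auto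

definition vals :: "bdm_state \<Rightarrow> int multiset" where
  "vals s = add_mset (fst (snd s)) (mset (fst s))"

definition top_val :: "bdm_state \<Rightarrow> int" where
  "top_val s = Max (set_mset (vals s))"

lemma vals_simp [simp]: "vals (bs, d, T, t) = add_mset d (mset bs)"
  by (simp add: vals_def)

lemma dcoord_simp [simp]: "dcoord (bs, d, T, t) = d"
  by (simp add: dcoord_def)

lemma dcoord_in_vals: "dcoord s \<in># vals s"
  by (simp add: dcoord_def vals_def)

lemma top_val_in: "top_val s \<in># vals s"
  unfolding top_val_def by (rule Max_in) (auto simp: vals_def)

lemma le_top_val: "x \<in># vals s \<Longrightarrow> x \<le> top_val s"
  unfolding top_val_def by simp

lemma top_val_cong: "vals s = vals s' \<Longrightarrow> top_val s = top_val s'"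
  by (simp add: top_val_def)

text \<open>Stating the constraint through \<open>vals\<close> makes membership visibly invariant
  under swaps.\<close>

lemma bdm_S_iff:
  "(bs, d, T, t) \<in> bdm_S M \<longleftrightarrow> length bs = M \<and> 1 \<le> t \<and> t \<le> M + 1 \<and>
     \<Sum>\<^sub># (vals (bs, d, T, t)) + T = 0 \<and> 0 \<le> T \<and> T \<le> int M"
  by (auto simp: bdm_S_def sum_mset_sum_list)

locale bdm =
  fixes M q :: nat
  assumes M: "1 \<le> M" and q: "2 \<le> q"
begin

abbreviation step :: "bdm_state \<Rightarrow> bdm_state pmf" where
  "step \<equiv> bdm_step M q"

section \<open>One pass of comparisons\<close>

lemma step_compare:
  assumes s': "s' \<in> set_pmf (step (bs, d, T, t))" and t: "1 \<le> t" "t \<le> M" and len: "length bs = M"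
  obtains bs' d' where "s' = (bs', d', T, t + 1)" "length bs' = M"
    "add_mset d' (mset bs') = add_mset d (mset bs)" "d \<le> d'"
proof (cases "d < bs ! (t - 1)")
  case True
  have "t - 1 < length bs" using t len by simp
  then have "add_mset (bs ! (t - 1)) (mset (bs[t - 1 := d])) = add_mset d (mset bs)"
    by (simp add: mset_update)
  moreover have "s' = (bs, d, T, t + 1) \<or> s' = (bs[t - 1 := d], bs ! (t - 1), T, t + 1)"
    using s' t True by (auto simp: bdm_step_def split: if_splits)
  ultimately show thesis using that True len by auto
next
  case False
  then show thesis using that s' t len by (auto simp: bdm_step_def)
qed

lemma finite_step: "finite (set_pmf (step s))"
  by (cases s) (auto simp: bdm_step_def)

sublocale S: finite_kernel step "bdm_S M"
proof
  fix s assume s: "s \<in> bdm_S M"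
  obtain bs d T t where st: "s = (bs, d, T, t)" by (cases s)
  show "set_pmf (step s) \<subseteq> bdm_S M"
  proof
    fix s' assume s': "s' \<in> set_pmf (step s)"
    show "s' \<in> bdm_S M"
    proof (cases "t \<le> M")
      case True
      have "1 \<le> t" "length bs = M" using s by (auto simp: st bdm_S_iff)
      from step_compare[OF s'[unfolded st] this(1) True this(2)] obtain bs' d' where
        "s' = (bs', d', T, t + 1)" "length bs' = M" "add_mset d' (mset bs') = add_mset d (mset bs)" .
      then show ?thesis using s True by (simp add: st bdm_S_iff)
    next
      case False
      have "sum_list (map (\<lambda>x. x + 1) bs) = sum_list bs + int (length bs)"
        by (induction bs) auto
      then show ?thesis using False s s' unfolding st
        by (auto simp: bdm_step_def bdm_S_def split: if_splits)
    qed
  qed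
qed (rule finite_step)

lemma compare_phase:
  assumes "s' \<in> set_pmf (kernel_iter step r (bs, d, T, t))" "t + r \<le> M + 1" "1 \<le> t" "length bs = M"
  shows "\<exists>bs' d'. s' = (bs', d', T, t + r) \<and> length bs' = M \<and>
    add_mset d' (mset bs') = add_mset d (mset bs) \<and> d \<le> d'"
  using assms
proof (induction r arbitrary: bs d t)
  case (Suc r)
  obtain u where u: "u \<in> set_pmf (step (bs, d, T, t))" "s' \<in> set_pmf (kernel_iter step r u)"
    using Suc.prems(1) by (auto simp: kernel_iter_Suc')
  have "t \<le> M" using Suc.prems by simp
  from u(1) Suc.prems(3) this Suc.prems(4) obtain bs' d' where "u = (bs', d', T, t + 1)"
    "length bs' = M" "add_mset d' (mset bs') = add_mset d (mset bs)" "d \<le> d'"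
    by (rule step_compare)
  with Suc.IH[of bs' d' "t + 1"] u(2) Suc.prems(2) show ?case
    by fastforce
qed auto

lemma finite_iter_step: "finite (set_pmf (kernel_iter step r s))"
  by (induction r) (auto simp: kernel_iter_Suc finite_step)

lemma expect_iter_step_Suc:
  "expect (kernel_iter step (Suc r) s) f = expect (step s) (\<lambda>u. expect (kernel_iter step r u) f)"
  unfolding kernel_iter_Suc' by (intro expect_bind_finite finite_step finite_iter_step)

lemma expect_swap:
  assumes "t \<le> M" "d < bs ! (t - 1)"
  shows "expect (step (bs, d, T, t)) f = 1 / real q * f (bs, d, T, t + 1)
     + (1 - 1 / real q) * f (bs[t - 1 := d], bs ! (t - 1), T, t + 1)"
  using assms q by (simp add: bdm_step_def)

lemma drop_pred:
  "1 \<le> t \<Longrightarrow> t \<le> length bs \<Longrightarrow> drop (t - 1) bs = bs ! (t - 1) # drop t bs"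
  by (metis Cons_nth_drop_Suc Suc_le_lessD Suc_pred' less_le_trans zero_less_one)

text \<open>Invariant: the maximum \<open>m\<close> is held by \<open>d\<close> or lies at position
  \<open>t\<close> or later. When the comparison meets \<open>m\<close> itself, a swap closes the
  gap; the swap fails with probability \<open>1 / q \<le> 1 / 2\<close>, and the gap then stays at
  most \<open>f m - f d\<close> because \<open>d\<close> never decreases. After any other comparison
  the invariant persists with no larger gap, and the induction hypothesis applies.\<close>

lemma expect_gap_le:
  fixes f :: "int \<Rightarrow> real"
  assumes f: "mono f"
  assumes "t + r = M + 1" "1 \<le> t" "length bs = M"
    and "m \<in> insert d (set (drop (t - 1) bs))" "\<forall>x \<in> insert d (set bs). x \<le> m"
  shows "expect (kernel_iter step r (bs, d, T, t)) (\<lambda>s. f m - f (dcoord s)) \<le> (f m - f d) / 2"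
  using assms(2-)
proof (induction r arbitrary: bs d t)
  case 0
  then show ?case by simp
next
  case (Suc r)
  have t: "t \<le> M" and tl: "t - 1 < length bs" using Suc.prems by auto
  have dr: "drop (t - 1) bs = bs ! (t - 1) # drop t bs"
    using Suc.prems t by (intro drop_pred) auto
  define F where "F = (\<lambda>u. expect (kernel_iter step r u) (\<lambda>s. f m - f (dcoord s)))"
  have E: "expect (kernel_iter step (Suc r) (bs, d, T, t)) (\<lambda>s. f m - f (dcoord s))
      = expect (step (bs, d, T, t)) F"
    unfolding F_def by (rule expect_iter_step_Suc)
  have IH: "F (bs', d', T, t + 1) \<le> (f m - f d') / 2"
    if "length bs' = M" "m \<in> insert d' (set (drop t bs'))" "\<forall>x \<in> insert d' (set bs'). x \<le> m"
    for bs' d'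
    unfolding F_def using Suc.IH[of "t + 1" bs' d'] that Suc.prems by simp
  have b_mem: "bs ! (t - 1) \<in> set bs" using tl by simp
  have dm: "f d \<le> f m" using Suc.prems by (intro monoD[OF f]) auto
  show ?case
  proof (cases "d < bs ! (t - 1)")
    case True
    define b where "b = bs ! (t - 1)"
    define bs' where "bs' = bs[t - 1 := d]"
    have bm: "b \<le> m" using Suc.prems(5) b_mem by (auto simp: b_def)
    have bs': "length bs' = M" "drop t bs' = drop t bs" "\<forall>x \<in> insert b (set bs'). x \<le> m"
      using Suc.prems bm set_update_subset_insert[of bs "t - 1" d]
      by (auto simp: bs'_def)
    have db: "f d \<le> f b" using True by (intro monoD[OF f]) (simp add: b_def)
    have p: "0 \<le> 1 / real q" "1 / real q \<le> 1 / 2" using q by auto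
    have "1 / real q * F (bs, d, T, t + 1) + (1 - 1 / real q) * F (bs', b, T, t + 1)
        \<le> (f m - f d) / 2"
    proof (cases "b = m")
      case True
      have "F (bs, d, T, t + 1) \<le> expect (kernel_iter step r (bs, d, T, t + 1)) (\<lambda>s. f m - f d)"
        unfolding F_def
      proof (intro expect_mono_finite finite_iter_step)
        fix s assume "s \<in> set_pmf (kernel_iter step r (bs, d, T, t + 1))"
        from compare_phase[OF this] Suc.prems show "f m - f (dcoord s) \<le> f m - f d"
          using monoD[OF f] by auto
      qed
      then have "1 / real q * F (bs, d, T, t + 1) \<le> 1 / real q * (f m - f d)"
        using p by (intro mult_left_mono) auto
      also have "\<dots> \<le> 1 / 2 * (f m - f d)" using p dm by (intro mult_right_mono) auto
      finally have 1: "1 / real q * F (bs, d, T, t + 1) \<le> (f m - f d) / 2" by simp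
      have "F (bs', b, T, t + 1) \<le> 0" using IH[of bs' b] bs' True by simp
      then have "(1 - 1 / real q) * F (bs', b, T, t + 1) \<le> 0"
        using p by (intro mult_nonneg_nonpos) auto
      then show ?thesis using 1 by linarith
    next
      case False
      have "m \<noteq> d" using True bm by (auto simp: b_def)
      then have m: "m \<in> set (drop t bs)" using False Suc.prems(4) dr by (auto simp: b_def)
      have "F (bs, d, T, t + 1) \<le> (f m - f d) / 2" using IH[of bs d] m Suc.prems by simp
      moreover have "F (bs', b, T, t + 1) \<le> (f m - f d) / 2"
        using IH[of bs' b] bs' m db by simp
      ultimately have "1 / real q * F (bs, d, T, t + 1) + (1 - 1 / real q) * F (bs', b, T, t + 1)
          \<le> 1 / real q * ((f m - f d) / 2) + (1 - 1 / real q) * ((f m - f d) / 2)"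
        using p by (intro add_mono mult_left_mono) auto
      also have "\<dots> = (f m - f d) / 2" by (simp only: distrib_right[symmetric]) simp
      finally show ?thesis .
    qed
    then show ?thesis unfolding E using expect_swap[OF t True] by (simp add: b_def bs'_def)
  next
    case False
    \<comment> \<open>Without a swap, \<open>m\<close> could be left behind only at position
      \<open>t\<close>; then \<open>m \<le> d\<close>, so \<open>d\<close> equals \<open>m\<close>
      as well.\<close>
    have "m \<in> insert d (set (drop t bs))" using Suc.prems(4,5) dr False b_mem
      by (metis insertE insertI1 insert_iff list.simps(15) order_antisym not_less)
    then have "F (bs, d, T, t + 1) \<le> (f m - f d) / 2" using IH Suc.prems by simp
    then show ?thesis unfolding E using t False by (simp add: bdm_step_def)
  qed
qed

text \<open>The same invariant, followed along the single path on which every possible swap happens.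
  Each of its steps has probability 1 or \<open>1 - 1 / q\<close>, hence at least
  \<open>1 / 2\<close>.\<close>

lemma pmf_reach_top:
  assumes "t + r = M + 1" "1 \<le> t" "length bs = M"
    and "m \<in> insert d (set (drop (t - 1) bs))" "\<forall>x \<in> insert d (set bs). x \<le> m"
  shows "\<exists>s'. (1 / 2) ^ r \<le> pmf (kernel_iter step r (bs, d, T, t)) s' \<and> dcoord s' = m"
  using assms
proof (induction r arbitrary: bs d t)
  case 0
  then show ?case by (intro exI[of _ "(bs, d, T, t)"]) auto
next
  case (Suc r)
  have t: "t \<le> M" and tl: "t - 1 < length bs" using Suc.prems by auto
  have dr: "drop (t - 1) bs = bs ! (t - 1) # drop t bs"
    using Suc.prems t by (intro drop_pred) auto
  define b where "b = bs ! (t - 1)"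
  have b: "b \<in> set bs" using tl by (simp add: b_def)
  have chain: ?case if "1 / 2 \<le> pmf (step (bs, d, T, t)) (bs', d', T, t + 1)"
    "length bs' = M" "m \<in> insert d' (set (drop t bs'))" "\<forall>x \<in> insert d' (set bs'). x \<le> m"
    for bs' d'
  proof -
    have "\<exists>s'. (1 / 2) ^ r \<le> pmf (kernel_iter step r (bs', d', T, t + 1)) s' \<and> dcoord s' = m"
      by (rule Suc.IH) (use that Suc.prems(1) in auto)
    then obtain s' where s': "(1 / 2) ^ r \<le> pmf (kernel_iter step r (bs', d', T, t + 1)) s'"
      "dcoord s' = m" by blast
    then show ?thesis
      using pmf_kernel_iter_add_ge[of "1 / 2" step 1 "(bs, d, T, t)" "(bs', d', T, t + 1)" "(1 / 2) ^ r" r s']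
        that(1) by (intro exI[of _ s']) simp
  qed
  show ?case
  proof (cases "d < b")
    case True
    have "1 / 2 \<le> 1 - 1 / real q" using q by (simp add: field_simps)
    also have "\<dots> = pmf (bernoulli_pmf (1 / real q)) False" using q by simp
    also have "\<dots> \<le> pmf (step (bs, d, T, t)) (bs[t - 1 := d], b, T, t + 1)"
      using True t pmf_map_ge[of "bernoulli_pmf (1 / real q)" False
        "\<lambda>c. if c then (bs, d, T, t + 1) else (bs[t - 1 := d], b, T, t + 1)"]
      unfolding bdm_step_def b_def by simp
    finally show ?thesis
    proof (rule chain)
      show "m \<in> insert b (set (drop t (bs[t - 1 := d])))"
        using Suc.prems(2,4,5) dr True b by (auto simp: b_def)
      show "\<forall>x \<in> insert b (set (bs[t - 1 := d])). x \<le> m"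
        using Suc.prems b set_update_subset_insert[of bs "t - 1" d] by auto
    qed (use Suc.prems in auto)
  next
    case False
    have "m \<in> insert d (set (drop t bs))" using Suc.prems(4,5) dr False b
      by (metis b_def insertE insertI1 insert_iff list.simps(15) order_antisym not_less)
    then show ?thesis using t False Suc.prems
      by (intro chain[of bs d]) (auto simp: bdm_step_def b_def)
  qed
qed

section \<open>The chain observed at \<open>t = M + 1\<close>\<close>

definition sweep :: "bdm_state \<Rightarrow> bdm_state pmf" where
  "sweep = kernel_iter step (M + 1)"

text \<open>\<open>T\<close> counts sweeps and is reduced modulo \<open>M + 1\<close>, so that a
  sweep leads from \<open>Z T\<close> to \<open>Z (Suc T)\<close> even where the phase wraps from
  \<open>M\<close> to 0.\<close>

definition Z :: "nat \<Rightarrow> bdm_state set" where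
  "Z T = bdm_S_Tt M (int (T mod (M + 1))) (M + 1)"

text \<open>The deterministic step that opens a sweep. The comparisons after it preserve
  \<open>vals\<close> and \<open>T\<close>, so whatever depends only on these is known once
  \<open>charge\<close> is done.\<close>

definition charge :: "bdm_state \<Rightarrow> bdm_state" where
  "charge s = (case s of (bs, d, T, t) \<Rightarrow>
     if T < int M then (bs, d - 1, T + 1, 1) else (map (\<lambda>x. x + 1) bs, d, 0, 1))"

lemma Z_iff: "(bs, d, T', t) \<in> Z T \<longleftrightarrow> t = M + 1 \<and> T' = int (T mod (M + 1)) \<and> length bs = M \<and>
    \<Sum>\<^sub># (vals (bs, d, T', t)) + T' = 0"
proof -
  have "T mod (M + 1) \<le> M" using mod_less_divisor[of "M + 1" T] by simp
  then show ?thesis by (auto simp: Z_def bdm_S_Tt_def bdm_S_iff)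
qed

lemma Z_subset: "Z T \<subseteq> bdm_S M"
  by (auto simp: Z_def bdm_S_Tt_def)

lemma Z_cong: "T mod (M + 1) = T' mod (M + 1) \<Longrightarrow> Z T = Z T'"
  by (simp add: Z_def)

lemma step_Z:
  assumes "s \<in> Z T" shows "step s = return_pmf (charge s)"
  using assms by (cases s) (auto simp: Z_iff bdm_step_def charge_def)

lemma sweep_eq:
  assumes "s \<in> Z T" shows "sweep s = kernel_iter step M (charge s)"
  using kernel_iter_Suc'[of step M s] step_Z[OF assms] by (simp add: bind_return_pmf sweep_def)

lemma charge_Z:
  assumes "s \<in> Z T"
  obtains bs d where "charge s = (bs, d, int (Suc T mod (M + 1)), 1)" "length bs = M"
    "\<Sum>\<^sub># (vals (charge s)) + int (Suc T mod (M + 1)) = 0"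
proof -
  obtain bs d T' t where s: "s = (bs, d, T', t)" by (cases s)
  have T': "T' = int (T mod (M + 1))" using assms by (simp add: s Z_iff)
  have inS: "charge s \<in> bdm_S M"
    using S.closed[of s] assms Z_subset[of T] step_Z[OF assms] by auto
  have "charge s = (fst (charge s), dcoord (charge s), int (Suc T mod (M + 1)), 1)"
  proof (cases "T mod (M + 1) < M")
    case True
    then have "Suc T mod (M + 1) = Suc (T mod (M + 1))" by (simp add: mod_Suc)
    then show ?thesis using True by (simp add: s charge_def T' dcoord_def)
  next
    case False
    have "T mod (M + 1) < M + 1" by (rule mod_less_divisor) simp
    then have "T mod (M + 1) = M" using False by linarith
    then have "Suc T mod (M + 1) = 0" by (simp add: mod_Suc)
    then show ?thesis using False by (simp add: s charge_def T' dcoord_def)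
  qed
  then show thesis using that inS by (metis bdm_S_iff)
qed

lemma sweep_support:
  assumes s: "s \<in> Z T" and s': "s' \<in> set_pmf (sweep s)"
  shows "s' \<in> Z (Suc T)" "vals s' = vals (charge s)"
proof -
  obtain bs d where c: "charge s = (bs, d, int (Suc T mod (M + 1)), 1)" "length bs = M"
    "\<Sum>\<^sub># (vals (charge s)) + int (Suc T mod (M + 1)) = 0"
    using charge_Z[OF s] .
  obtain bs' d' where "s' = (bs', d', int (Suc T mod (M + 1)), M + 1)" "length bs' = M"
    "add_mset d' (mset bs') = add_mset d (mset bs)"
    using compare_phase[of s' M bs d "int (Suc T mod (M + 1))" 1] s' c
    by (auto simp: sweep_eq[OF s])
  then show "s' \<in> Z (Suc T)" "vals s' = vals (charge s)"
    using c by (auto simp: Z_iff)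
qed

sublocale Sw: finite_kernel sweep "\<Union>T. Z T"
proof
  show "finite (set_pmf (sweep s))" for s
    unfolding sweep_def by (rule finite_iter_step)
qed (use sweep_support(1) in blast)

lemma iter_sweep_support:
  assumes "s \<in> Z T" shows "set_pmf (kernel_iter sweep n s) \<subseteq> Z (T + n)"
proof (induction n)
  case (Suc n)
  then show ?case using sweep_support(1) by (auto simp: kernel_iter_Suc)
qed (use assms in simp)

text \<open>The top value after the sweep is that of \<open>charge s\<close>, a constant under the
  expectation; only \<open>dcoord\<close> is random.\<close>

lemma expect_sweep_gap:
  assumes s: "s \<in> Z T" and f: "mono f"
  shows "expect (sweep s) (\<lambda>s'. f (top_val s') - f (dcoord s'))
    \<le> (f (top_val (charge s)) - f (dcoord (charge s))) / 2"
proof -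
  obtain bs d where c: "charge s = (bs, d, int (Suc T mod (M + 1)), 1)" "length bs = M"
    using charge_Z[OF s] by metis
  have "expect (sweep s) (\<lambda>s'. f (top_val s') - f (dcoord s'))
      = expect (sweep s) (\<lambda>s'. f (top_val (charge s)) - f (dcoord s'))"
    by (intro expect_cong) (use sweep_support(2)[OF s] top_val_cong in metis)
  also have "\<dots> \<le> (f (top_val (charge s)) - f d) / 2"
    unfolding sweep_eq[OF s] c(1)
    using c top_val_in[of "charge s"] le_top_val[of _ "charge s"]
    by (intro expect_gap_le f) auto
  finally show ?thesis using c by simp
qed

lemma pmf_sweep_reach_top:
  assumes s: "s \<in> Z T"
  obtains s' where "s' \<in> Z (Suc T)" "vals s' = vals (charge s)" "(1 / 2) ^ M \<le> pmf (sweep s) s'"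
    "dcoord s' = top_val s'"
proof -
  obtain bs d where c: "charge s = (bs, d, int (Suc T mod (M + 1)), 1)" "length bs = M"
    using charge_Z[OF s] by metis
  obtain s' where s': "(1 / 2) ^ M \<le> pmf (sweep s) s'" "dcoord s' = top_val (charge s)"
    unfolding sweep_eq[OF s] c(1)
    using pmf_reach_top[of 1 M bs "top_val (charge s)" d "int (Suc T mod (M + 1))"]
      c top_val_in[of "charge s"] le_top_val[of _ "charge s"] by auto
  have "0 < pmf (sweep s) s'" by (rule less_le_trans[OF _ s'(1)]) simp
  then have "s' \<in> set_pmf (sweep s)" by (simp add: set_pmf_iff)
  from sweep_support[OF s this] s' top_val_cong[of s' "charge s"] show thesis
    by (intro that) auto
qed

subsection \<open>A Lyapunov function\<close>

definition phase :: "bdm_state \<Rightarrow> int" where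
  "phase s = fst (snd (snd s))"

lemma phase_simp [simp]: "phase (bs, d, T, t) = T"
  by (simp add: phase_def)

lemma phase_Z: "s \<in> Z T \<Longrightarrow> phase s = int (T mod (M + 1))"
  by (cases s) (auto simp: Z_iff)

lemma phase_charge:
  assumes "s \<in> Z T" shows "phase (charge s) = int (Suc T mod (M + 1))"
proof -
  obtain bs d where "charge s = (bs, d, int (Suc T mod (M + 1)), 1)"
    using charge_Z[OF assms] by metis
  then show ?thesis by simp
qed

lemma phase_bounds:
  assumes "s \<in> Z T" shows "0 \<le> phase s" "phase s \<le> int M"
proof -
  have "T mod (M + 1) < M + 1" by (rule mod_less_divisor) simp
  then show "0 \<le> phase s" "phase s \<le> int M" unfolding phase_Z[OF assms] by linarith+
qed

text \<open>Any small \<open>\<theta>\<close> works: the sweep multiplies the exponential energy by about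
  \<open>1 + \<theta>/(M+1) - \<theta>/M\<close> up to \<open>O(\<theta>\<^sup>2)\<close>.\<close>

definition \<theta> :: real where "\<theta> = 1 / (4 * (real M + 1))"
definition \<kappa> :: real where "\<kappa> = \<theta> / (real M + 1)"
definition \<eta> :: real where "\<eta> = 1 - exp (- \<theta>)"

text \<open>Levels of a state sum to 0, and the step at \<open>t = M + 1\<close> acts on them in the same way for
  all \<open>T\<close>: it lowers that of \<open>d\<close> by \<open>M\<close> and raises all others by 1.\<close>

definition level :: "int \<Rightarrow> int \<Rightarrow> int" where
  "level T x = (int M + 1) * x + T"

definition expo :: "int \<Rightarrow> int \<Rightarrow> real" where
  "expo T x = exp (\<kappa> * of_int (level T x))"

definition energy :: "bdm_state \<Rightarrow> real" where
  "energy s = (\<Sum>x\<in>#vals s. expo (phase s) x)"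

definition gap :: "bdm_state \<Rightarrow> real" where
  "gap s = expo (phase s) (top_val s) - expo (phase s) (dcoord s)"

text \<open>The energy alone only drifts down when \<open>d\<close> is near the top value. The gap term pays for
  the other states, since a sweep halves the gap in expectation.\<close>

definition W :: "bdm_state \<Rightarrow> real" where
  "W s = energy s + 4 * \<eta> * gap s"

section \<open>Numerical bounds for the parameters\<close>

lemma \<theta>_bounds: "0 < \<theta>" "\<theta> \<le> 1 / 8" and \<kappa>_bounds: "0 < \<kappa>" "\<kappa> \<le> 1 / 16"
proof -
  show \<theta>: "0 < \<theta>" "\<theta> \<le> 1 / 8" using M by (auto simp: \<theta>_def divide_simps)
  show "0 < \<kappa>" using \<theta> by (simp add: \<kappa>_def)
  have "\<kappa> \<le> (1 / 8) / 2" unfolding \<kappa>_def using \<theta> M by (intro frac_le) auto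
  then show "\<kappa> \<le> 1 / 16" by simp
qed

lemma \<kappa>_mult: "\<kappa> * (real M + 1) = \<theta>"
  using M by (simp add: \<kappa>_def)

lemma \<eta>_bounds: "0 < \<eta>" "\<eta> \<le> \<theta>" "\<theta> - \<theta>\<^sup>2 / 2 \<le> \<eta>"
proof -
  show "0 < \<eta>" using \<theta>_bounds by (simp add: \<eta>_def)
  show "\<eta> \<le> \<theta>" using exp_ge_add_one_self[of "- \<theta>"] by (simp add: \<eta>_def)
  \<comment> \<open>The two quadratics multiply to at least 1, so the lower Taylor bound for
    \<open>exp \<theta>\<close> becomes an upper bound for \<open>exp (- \<theta>)\<close>.\<close>
  have "1 \<le> 1 + \<theta> ^ 4 / 4" by simp
  also have "\<dots> = (1 + \<theta> + \<theta>\<^sup>2 / 2) * (1 - \<theta> + \<theta>\<^sup>2 / 2)"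
    by (simp add: algebra_simps power2_eq_square power4_eq_xxxx)
  also have "\<dots> \<le> exp \<theta> * (1 - \<theta> + \<theta>\<^sup>2 / 2)"
    using \<theta>_bounds exp_lower_Taylor_quadratic[of \<theta>] by (intro mult_right_mono) auto
  finally have "exp (- \<theta>) \<le> 1 - \<theta> + \<theta>\<^sup>2 / 2"
    by (simp add: exp_minus field_simps)
  then show "\<theta> - \<theta>\<^sup>2 / 2 \<le> \<eta>" by (simp add: \<eta>_def)
qed

lemma exp_\<kappa>_le: "exp \<kappa> \<le> 1 / (1 - \<kappa>)"
  using exp_ge_add_one_self[of "- \<kappa>"] \<kappa>_bounds by (simp add: exp_minus field_simps)

lemma exp_\<kappa>_bound: "exp \<kappa> \<le> 16 / 15"
proof -
  have "1 / (1 - \<kappa>) \<le> 1 / (1 - 1 / 16)" using \<kappa>_bounds by (intro divide_left_mono) auto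
  then show ?thesis using exp_\<kappa>_le by simp
qed

text \<open>By \<open>exp \<kappa> \<le> 1 / (1 - \<kappa>)\<close> it suffices that
  \<open>\<kappa> * M < \<eta> * (1 - 2 * \<eta>)\<close>. The left side is
  \<open>\<theta> - \<kappa>\<close>, where the 4 in the definition of \<open>\<theta>\<close> makes
  \<open>\<kappa> = 4 * \<theta>\<^sup>2\<close>; the right side is at least
  \<open>\<theta> - 5 / 2 * \<theta>\<^sup>2\<close>. What remains is 5/2 < 4.\<close>

lemma contraction_factor: "exp \<kappa> * (1 - \<eta> * (1 - 2 * \<eta>) / real M) < 1"
proof -
  have M0: "0 < real M" using M by simp
  have "\<theta> * (1 - 5 / 2 * \<theta>) \<le> (\<theta> - \<theta>\<^sup>2 / 2) * (1 - 2 * \<theta>)"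
  proof -
    have "(\<theta> - \<theta>\<^sup>2 / 2) * (1 - 2 * \<theta>) = \<theta> * (1 - 5 / 2 * \<theta>) + \<theta> ^ 3"
      by (simp add: field_simps power2_eq_square power3_eq_cube)
    then show ?thesis using \<theta>_bounds by simp
  qed
  also have "\<dots> \<le> \<eta> * (1 - 2 * \<eta>)"
    using \<eta>_bounds \<theta>_bounds by (intro mult_mono) auto
  finally have 1: "\<theta> * (1 - 5 / 2 * \<theta>) \<le> \<eta> * (1 - 2 * \<eta>)" .
  have "\<kappa> * real M < \<theta> * (1 - 5 / 2 * \<theta>)"
  proof -
    have t: "\<theta> * (real M + 1) = 1 / 4" by (simp add: \<theta>_def field_simps)
    have "\<kappa> * real M = \<theta> - \<kappa>" using \<kappa>_mult by (simp add: algebra_simps)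
    moreover have "\<kappa> = 4 * \<theta>\<^sup>2"
      using t M by (simp add: \<kappa>_def power2_eq_square field_simps)
    moreover have "\<theta> * (1 - 5 / 2 * \<theta>) = \<theta> - 5 / 2 * \<theta>\<^sup>2"
      by (simp add: algebra_simps power2_eq_square)
    moreover have "0 < \<theta>\<^sup>2" using \<theta>_bounds by simp
    ultimately show ?thesis by linarith
  qed
  then have "\<kappa> < \<eta> * (1 - 2 * \<eta>) / real M" using 1 M0 by (simp add: pos_less_divide_eq)
  then have "exp \<kappa> * (1 - \<eta> * (1 - 2 * \<eta>) / real M) < exp \<kappa> * (1 - \<kappa>)" by simp
  also have "\<dots> \<le> 1" using exp_\<kappa>_le \<kappa>_bounds by (simp add: pos_le_divide_eq)
  finally show ?thesis .
qed

section \<open>The effect of \<open>charge\<close> on the exponentials\<close>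

lemma expo_pos: "0 < expo T x"
  by (simp add: expo_def)

lemma mono_expo: "mono (expo T)"
  using \<kappa>_bounds by (auto simp: mono_def expo_def level_def intro!: mult_left_mono)

lemma gap_nonneg: "0 \<le> gap s"
  using monoD[OF mono_expo le_top_val[OF dcoord_in_vals]] by (simp add: gap_def)

lemma expo_next: "expo (T + 1) x = exp \<kappa> * expo T x"
  by (simp add: expo_def level_def exp_add[symmetric] algebra_simps)

lemma expo_down: "expo T (x - 1) = (1 - \<eta>) * expo T x"
proof -
  have "\<kappa> * of_int (level T (x - 1)) = - \<theta> + \<kappa> * of_int (level T x)"
    using \<kappa>_mult by (simp add: level_def algebra_simps)
  then show ?thesis by (simp only: expo_def \<eta>_def exp_add) simp
qed

text \<open>The value rises by 1, which adds \<open>M + 1\<close> to the level, while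
  \<open>T\<close> drops by \<open>M\<close>: the net change of level is 1, as in
  \<open>expo_next\<close>.\<close>

lemma expo_wrap: "expo 0 (x + 1) = exp \<kappa> * expo (int M) x"
  by (simp add: expo_def level_def exp_add[symmetric] algebra_simps)

lemma expo_charge:
  assumes s: "s \<in> Z T"
  shows "energy (charge s) = exp \<kappa> * (energy s - \<eta> * expo (phase s) (dcoord s))"
    and "expo (phase (charge s)) (dcoord (charge s)) = exp \<kappa> * (1 - \<eta>) * expo (phase s) (dcoord s)"
    and "expo (phase (charge s)) (top_val (charge s)) \<le> exp \<kappa> * expo (phase s) (top_val s)"
proof -
  obtain bs d T' t where st: "s = (bs, d, T', t)" by (cases s)
  have phase_s: "phase s = T'" and dcoord_s: "dcoord s = d" and vals_s: "vals s = add_mset d (mset bs)"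
    by (auto simp: st)
  define c where "c = charge s"
  obtain f where f: "vals c = add_mset (dcoord c) (image_mset f (mset bs))"
    "\<And>x. expo (phase c) (f x) = exp \<kappa> * expo T' x"
    and d: "expo (phase c) (dcoord c) = exp \<kappa> * (1 - \<eta>) * expo T' d"
  proof (cases "T' < int M")
    case True
    then show thesis by (intro that[of "\<lambda>x. x"]) (auto simp: c_def st charge_def expo_next expo_down)
  next
    case False
    moreover have "T mod (M + 1) < M + 1" by (rule mod_less_divisor) simp
    ultimately have T': "T' = int M" using s unfolding st Z_iff by linarith
    \<comment> \<open>At the wrap \<open>d\<close> stays while the others rise by 1, which amounts
      to raising all values by 1 and lowering \<open>d\<close> by 1.\<close>
    have "expo 0 d = exp \<kappa> * (1 - \<eta>) * expo T' d"
      using expo_wrap[of "d - 1"] by (simp add: expo_down T')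
    then show thesis using False
      by (intro that[of "\<lambda>x. x + 1"]) (auto simp: c_def st charge_def expo_wrap T')
  qed
  have e2: "expo (phase c) (dcoord c) = exp \<kappa> * (1 - \<eta>) * expo (phase s) (dcoord s)"
    using d by (simp add: phase_s dcoord_s vals_s)
  have e1: "energy c = exp \<kappa> * (energy s - \<eta> * expo (phase s) (dcoord s))"
    by (simp add: energy_def f d phase_s dcoord_s vals_s image_mset.compositionality comp_def
        sum_mset_distrib_left[symmetric] algebra_simps)
  \<comment> \<open>For the top value there is only an inequality: if \<open>d\<close> was the
    strict maximum, lowering it can lower the top as well.\<close>
  have "top_val c \<in># vals c" by (rule top_val_in)
  then consider "top_val c = dcoord c" | x where "x \<in> set bs" "top_val c = f x"
    unfolding f(1) by auto
  then have e3: "expo (phase c) (top_val c) \<le> exp \<kappa> * expo (phase s) (top_val s)"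
  proof cases
    case 1
    have "(1 - \<eta>) * expo T' d \<le> 1 * expo T' d"
      using \<eta>_bounds expo_pos[of T' d] by (intro mult_right_mono) auto
    also have "\<dots> \<le> expo T' (top_val s)"
      using monoD[OF mono_expo le_top_val[of d s]] by (simp add: phase_s dcoord_s vals_s)
    finally show ?thesis using 1 d by (simp add: phase_s dcoord_s vals_s)
  next
    case (2 x)
    then show ?thesis
      using monoD[OF mono_expo le_top_val[of x s]] by (simp add: phase_s vals_s f)
  qed
  show "energy (charge s) = exp \<kappa> * (energy s - \<eta> * expo (phase s) (dcoord s))"
    "expo (phase (charge s)) (dcoord (charge s)) = exp \<kappa> * (1 - \<eta>) * expo (phase s) (dcoord s)"
    "expo (phase (charge s)) (top_val (charge s)) \<le> exp \<kappa> * expo (phase s) (top_val s)"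
    using e1 e2 e3 unfolding c_def by simp_all
qed

section \<open>Consequences of the levels summing to 0\<close>

lemma sum_level:
  assumes "s \<in> Z T"
  shows "(\<Sum>x\<in>#vals s. level (phase s) x) = 0"
proof -
  obtain bs d T' t where st: "s = (bs, d, T', t)" by (cases s)
  have len: "length bs = M" and sum: "d + sum_list bs + T' = 0"
    using assms by (auto simp: st Z_iff sum_mset_sum_list)
  have "(\<Sum>x\<in>#mset bs. level T' x) = (int M + 1) * sum_list bs + int (length bs) * T'"
    by (induction bs) (auto simp: level_def algebra_simps)
  then have "(\<Sum>x\<in>#vals s. level (phase s) x) = (int M + 1) * (d + sum_list bs + T')"
    by (simp add: st level_def len algebra_simps)
  then show ?thesis using sum by simp
qed

lemma size_vals: "s \<in> Z T \<Longrightarrow> size (vals s) = M + 1"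
  by (cases s) (auto simp: Z_iff)

lemma level_mono: "x \<le> y \<Longrightarrow> level T x \<le> level T y"
  by (simp add: level_def)

lemma level_top_nonneg:
  assumes "s \<in> Z T" shows "0 \<le> level (phase s) (top_val s)"
proof -
  have "(\<Sum>x\<in>#vals s. level (phase s) x)
      \<le> int (size (vals s)) * level (phase s) (top_val s)"
    by (intro sum_mset_image_le) (simp add: level_mono le_top_val)
  then show ?thesis using sum_level[OF assms] size_vals[OF assms] by (simp add: zero_le_mult_iff)
qed

text \<open>The other \<open>M\<close> levels are each at most the top level, and together with this
  one they sum to 0.\<close>

lemma level_lower:
  assumes s: "s \<in> Z T" and x: "x \<in># vals s"
  shows "- (int M * level (phase s) (top_val s)) \<le> level (phase s) x"
proof -
  obtain R where R: "vals s = add_mset x R" using x by (metis insert_DiffM)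
  have "(\<Sum>x\<in>#R. level (phase s) x) \<le> int (size R) * level (phase s) (top_val s)"
    by (intro sum_mset_image_le) (simp add: level_mono le_top_val R)
  moreover have "size R = M" using size_vals[OF s] R by simp
  moreover have "level (phase s) x + (\<Sum>x\<in>#R. level (phase s) x) = 0"
    using sum_level[OF s] R by simp
  ultimately show ?thesis by simp
qed

text \<open>Some level is at most 0, and its exponential is at most 1. Counting it separately gives
  the factor \<open>M\<close>. With \<open>M + 1\<close> the contraction would require
  \<open>\<theta> < \<eta> * (1 - 2 * \<eta>)\<close>, which fails because
  \<open>\<eta> \<le> \<theta>\<close>.\<close>

lemma energy_le:
  assumes s: "s \<in> Z T"
  shows "energy s \<le> 1 + real M * expo (phase s) (top_val s)"
proof -
  have "\<exists>x. x \<in># vals s \<and> level (phase s) x \<le> 0"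
  proof (rule ccontr)
    assume "\<not> ?thesis"
    then have "int (size (vals s)) * 1 \<le> (\<Sum>x\<in>#vals s. level (phase s) x)"
      by (intro sum_mset_image_ge) force
    then show False using sum_level[OF s] size_vals[OF s] by simp
  qed
  then obtain x where x: "x \<in># vals s" "level (phase s) x \<le> 0" by blast
  obtain R where R: "vals s = add_mset x R" using x by (metis insert_DiffM)
  have "(\<Sum>x\<in>#R. expo (phase s) x) \<le> real (size R) * expo (phase s) (top_val s)"
    by (intro sum_mset_image_le monoD[OF mono_expo] le_top_val) (simp add: R)
  moreover have "size R = M" using size_vals[OF s] R by simp
  moreover have "expo (phase s) x \<le> 1" using x \<kappa>_bounds by (simp add: expo_def mult_nonneg_nonpos)
  ultimately show ?thesis by (simp add: energy_def R)
qed

lemma ex_top_le_energy: "expo (phase s) (top_val s) \<le> energy s"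
proof -
  obtain R where R: "vals s = add_mset (top_val s) R" using top_val_in by (metis insert_DiffM)
  have "0 \<le> (\<Sum>x\<in>#R. expo (phase s) x)"
    using sum_mset_image_ge[of R 0 "expo (phase s)"] by (simp add: less_imp_le[OF expo_pos])
  then show ?thesis by (simp add: energy_def R)
qed

lemma energy_ge_1: "s \<in> Z T \<Longrightarrow> 1 \<le> energy s"
  using ex_top_le_energy[of s] level_top_nonneg[of s T] \<kappa>_bounds by (simp add: expo_def order_trans[rotated])

lemma energy_le_W: "energy s \<le> W s"
  using gap_nonneg[of s] \<eta>_bounds by (simp add: W_def)

text \<open>Let \<open>G\<close>, \<open>D\<close> be the exponentials of the top value and of
  \<open>d\<close>, and \<open>H = G - D\<close>. Up to the factor \<open>exp \<kappa>\<close>,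
  charging lowers the energy by \<open>\<eta> * D\<close> and turns the gap into at most
  \<open>H + \<eta> * D\<close>, which the sweep halves. With weight \<open>4 * \<eta>\<close> the
  total change is a loss of \<open>\<eta> * (1 - 2 * \<eta>) * G\<close>, which is a fixed fraction
  of the energy by \<open>energy_le\<close>, while the gap term falls from
  \<open>4 * \<eta> * H\<close> to at most \<open>3 * \<eta> * H\<close>.\<close>

lemma sweep_drift:
  obtains \<gamma> C where "0 \<le> \<gamma>" "\<gamma> < 1" "0 \<le> C"
    "\<And>s T. s \<in> Z T \<Longrightarrow> expect (sweep s) W \<le> \<gamma> * W s + C"
proof -
  define a where "a = \<eta> * (1 - 2 * \<eta>) / real M"
  \<comment> \<open>Here \<open>4 / 5\<close> is 3/4 times 16/15: the share of the gap term that
    survives, times the bound for \<open>exp \<kappa>\<close>.\<close>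
  define \<gamma> where "\<gamma> = max (exp \<kappa> * (1 - a)) (4 / 5)"
  define C where "C = exp \<kappa> * a"
  have M0: "0 < real M" using M by simp
  have eta: "\<eta> \<le> 1 / 8" using \<eta>_bounds \<theta>_bounds by simp
  have a: "0 \<le> a" using \<eta>_bounds eta M0 by (simp add: a_def)
  have "expect (sweep s) W \<le> \<gamma> * W s + C" if s: "s \<in> Z T" for s T
  proof -
    define V where "V = energy s"
    define G where "G = expo (phase s) (top_val s)"
    define H where "H = gap s"
    define D where "D = expo (phase s) (dcoord s)"
    define f where "f = expo (phase (charge s))"
    have DG: "D = G - H" by (simp add: D_def G_def H_def gap_def)
    have fin: "finite (set_pmf (sweep s))" unfolding sweep_def by (rule finite_iter_step)
    have "expect (sweep s) W
        = expect (sweep s) (\<lambda>s'. 4 * \<eta> * (f (top_val s') - f (dcoord s')) + energy (charge s))"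
    proof (rule expect_cong)
      fix s' assume s': "s' \<in> set_pmf (sweep s)"
      have "phase s' = phase (charge s)"
        using phase_Z[OF sweep_support(1)[OF s s']] phase_charge[OF s] by simp
      then show "W s' = 4 * \<eta> * (f (top_val s') - f (dcoord s')) + energy (charge s)"
        using sweep_support(2)[OF s s'] by (simp add: W_def energy_def gap_def f_def)
    qed
    also have "\<dots> = 4 * \<eta> * expect (sweep s) (\<lambda>s'. f (top_val s') - f (dcoord s')) + energy (charge s)"
      using fin by (rule expect_affine)
    also have "\<dots> \<le> 4 * \<eta> * ((f (top_val (charge s)) - f (dcoord (charge s))) / 2) + energy (charge s)"
      using expect_sweep_gap[OF s mono_expo[of "phase (charge s)"]] \<eta>_bounds
      by (intro add_right_mono mult_left_mono) (auto simp: f_def)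
    also have "\<dots> \<le> 4 * \<eta> * ((exp \<kappa> * G - exp \<kappa> * (1 - \<eta>) * D) / 2) + exp \<kappa> * (V - \<eta> * D)"
      using expo_charge[OF s] \<eta>_bounds
      by (intro add_mono mult_left_mono divide_right_mono diff_mono)
         (auto simp: f_def G_def D_def V_def)
    also have "\<dots> = exp \<kappa> * (V - \<eta> * (1 - 2 * \<eta>) * G + (3 * \<eta> - 2 * \<eta>\<^sup>2) * H)"
      unfolding DG by (simp add: field_simps power2_eq_square)
    also have "\<dots> \<le> exp \<kappa> * (V - a * (V - 1) + 3 * \<eta> * H)"
    proof (intro mult_left_mono add_mono diff_mono)
      have "\<eta> * (1 - 2 * \<eta>) * ((V - 1) / real M) \<le> \<eta> * (1 - 2 * \<eta>) * G"
        using energy_le[OF s] \<eta>_bounds eta M0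
        by (intro mult_left_mono) (auto simp: V_def G_def pos_divide_le_eq mult.commute)
      then show "a * (V - 1) \<le> \<eta> * (1 - 2 * \<eta>) * G" by (simp add: a_def)
      show "(3 * \<eta> - 2 * \<eta>\<^sup>2) * H \<le> 3 * \<eta> * H"
        using gap_nonneg[of s] by (intro mult_right_mono) (auto simp: H_def)
    qed auto
    also have "\<dots> = exp \<kappa> * (1 - a) * V + (3 / 4 * exp \<kappa>) * (4 * \<eta> * H) + C"
      by (simp add: C_def algebra_simps)
    also have "\<dots> \<le> \<gamma> * V + \<gamma> * (4 * \<eta> * H) + C"
      using exp_\<kappa>_bound energy_ge_1[OF s] gap_nonneg[of s] \<eta>_bounds
      by (intro add_mono mult_right_mono) (auto simp: \<gamma>_def V_def H_def)
    also have "\<dots> = \<gamma> * W s + C" by (simp add: W_def V_def H_def algebra_simps)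
    finally show ?thesis .
  qed
  moreover have "0 \<le> \<gamma>" "\<gamma> < 1"
    using contraction_factor by (auto simp: \<gamma>_def a_def)
  moreover have "0 \<le> C" using a by (simp add: C_def)
  ultimately show thesis using that by blast
qed

section \<open>Squares dominated by the energy\<close>

definition sq :: "bdm_state \<Rightarrow> int" where
  "sq s = (\<Sum>x\<in>#vals s. x\<^sup>2)"

lemma square_le_sq:
  assumes "x \<in># vals s" shows "x\<^sup>2 \<le> sq s"
proof -
  obtain R where R: "vals s = add_mset x R" using assms by (metis insert_DiffM)
  have "0 \<le> (\<Sum>x\<in>#R. x\<^sup>2)" using sum_mset_image_ge[of R 0 "\<lambda>x. x\<^sup>2"] by simp
  then show ?thesis by (simp add: sq_def R)
qed

lemma sq_nonneg: "0 \<le> sq s"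
  using square_le_sq[OF dcoord_in_vals] zero_le_power2 by (rule order_trans[rotated])

text \<open>All values are bounded linearly in the top level \<open>Y\<close>, and the exponential
  of the top level dominates \<open>Y\<^sup>2\<close>. The summand \<open>M\<close> absorbs the
  phase, so that a multiple of \<open>W\<close> bounds both \<open>dcoord\<close> and
  \<open>psi\<close>.\<close>

lemma sq_le_energy:
  obtains L where "0 < L" "\<And>s T. s \<in> Z T \<Longrightarrow> of_int (sq s) + real M \<le> L * energy s"
proof -
  define L where "L = (real M + 1) * (real M)\<^sup>2 * (4 / \<kappa>\<^sup>2 + 2) + real M"
  have L: "0 < L" using M by (auto simp: L_def intro!: add_nonneg_pos)
  have "of_int (sq s) + real M \<le> L * energy s" if s: "s \<in> Z T" for s T
  proof -
    define Y where "Y = real_of_int (level (phase s) (top_val s))"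
    have Y: "0 \<le> Y" using level_top_nonneg[OF s] by (simp add: Y_def)
    note ph = phase_bounds[OF s]
    have x: "(of_int (x\<^sup>2) :: real) \<le> (real M)\<^sup>2 * (Y + 1)\<^sup>2" if x: "x \<in># vals s" for x
    proof -
      have "level (phase s) x \<le> 1 * level (phase s) (top_val s)"
        using level_mono[OF le_top_val[OF x]] by simp
      also have "\<dots> \<le> int M * level (phase s) (top_val s)"
        using M level_top_nonneg[OF s] by (intro mult_right_mono) auto
      finally have "\<bar>level (phase s) x\<bar> \<le> int M * level (phase s) (top_val s)"
        using level_lower[OF s x] by linarith
      then have "\<bar>(int M + 1) * x\<bar> \<le> int M * (level (phase s) (top_val s) + 1)"
        using ph by (simp add: level_def algebra_simps)
      moreover have "1 * \<bar>x\<bar> \<le> (int M + 1) * \<bar>x\<bar>" by (intro mult_right_mono) auto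
      ultimately have "\<bar>x\<bar> \<le> int M * (level (phase s) (top_val s) + 1)" by (simp add: abs_mult)
      then have "real_of_int \<bar>x\<bar> \<le> real_of_int (int M * (level (phase s) (top_val s) + 1))"
        unfolding of_int_le_iff .
      then have "\<bar>real_of_int x\<bar> \<le> real M * (Y + 1)" by (simp add: Y_def)
      then have "\<bar>real_of_int x\<bar>\<^sup>2 \<le> (real M * (Y + 1))\<^sup>2" by (intro power_mono) auto
      then show ?thesis by (simp add: power_mult_distrib)
    qed
    have "of_int (sq s) \<le> real (size (vals s)) * ((real M)\<^sup>2 * (Y + 1)\<^sup>2)"
      unfolding sq_def of_int_sum_mset
      using x by (intro sum_mset_image_le)
    also have "\<dots> = (real M + 1) * (real M)\<^sup>2 * (Y + 1)\<^sup>2"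
      by (simp add: size_vals[OF s])
    also have "\<dots> \<le> (real M + 1) * (real M)\<^sup>2 * ((4 / \<kappa>\<^sup>2 + 2) * energy s)"
    proof (intro mult_left_mono)
      have "0 \<le> \<kappa> * Y" using Y \<kappa>_bounds by simp
      then have "(\<kappa> * Y)\<^sup>2 / 2 \<le> expo (phase s) (top_val s)"
        using exp_lower_Taylor_quadratic[of "\<kappa> * Y"] by (simp add: expo_def Y_def)
      then have "(\<kappa> * Y)\<^sup>2 / 2 \<le> energy s" using ex_top_le_energy[of s] by linarith
      then have "2 * Y\<^sup>2 \<le> 4 / \<kappa>\<^sup>2 * energy s"
        using \<kappa>_bounds by (simp add: field_simps power_mult_distrib)
      moreover have "(Y + 1)\<^sup>2 \<le> 2 * Y\<^sup>2 + 2"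
        using zero_le_power2[of "Y - 1"] by (simp add: power2_eq_square algebra_simps)
      moreover have "(4 / \<kappa>\<^sup>2 + 2) * energy s = 4 / \<kappa>\<^sup>2 * energy s + 2 * energy s"
        by (rule distrib_right)
      ultimately show "(Y + 1)\<^sup>2 \<le> (4 / \<kappa>\<^sup>2 + 2) * energy s"
        using energy_ge_1[OF s] by linarith
    qed auto
    finally have "of_int (sq s) \<le> (real M + 1) * (real M)\<^sup>2 * (4 / \<kappa>\<^sup>2 + 2) * energy s"
      by (simp add: mult_ac)
    moreover have "real M * 1 \<le> real M * energy s"
      using energy_ge_1[OF s] by (intro mult_left_mono) auto
    ultimately show ?thesis by (simp add: L_def algebra_simps)
  qed
  with L that show thesis by blast
qed

subsection \<open>Reaching the initial state\<close>

definition psi :: "bdm_state \<Rightarrow> int" where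
  "psi s = sq s - phase s"

text \<open>For \<open>T < M\<close> the 1 in the expansion of \<open>(d - 1)\<^sup>2\<close> is
  cancelled by the increase of \<open>T\<close>. For \<open>T = M\<close> the change is twice the
  sum of the \<open>b\<close>'s plus \<open>2 * M\<close>, which is \<open>- 2 * d\<close> because
  all values and \<open>T\<close> sum to 0.\<close>

lemma psi_charge:
  assumes s: "s \<in> Z T" shows "psi (charge s) = psi s - 2 * dcoord s"
proof -
  obtain bs d T' t where st: "s = (bs, d, T', t)" by (cases s)
  have len: "length bs = M" and sum: "d + sum_list bs + T' = 0"
    and T': "T' = int (T mod (M + 1))"
    using s by (auto simp: st Z_iff sum_mset_sum_list)
  have sq_st: "sq s = d\<^sup>2 + (\<Sum>x\<in>#mset bs. x\<^sup>2)" by (simp add: sq_def st)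
  show ?thesis
  proof (cases "T' < int M")
    case True
    then show ?thesis
      by (simp add: psi_def sq_st) (simp add: sq_def st charge_def power2_eq_square algebra_simps)
  next
    case False
    moreover have "T mod (M + 1) < M + 1" by (rule mod_less_divisor) simp
    ultimately have T'M: "T' = int M" using T' by linarith
    have "(\<Sum>x\<in>#mset bs. (x + 1)\<^sup>2) = (\<Sum>x\<in>#mset bs. x\<^sup>2) + 2 * sum_list bs + int (length bs)"
      by (induction bs) (auto simp: power2_eq_square algebra_simps)
    then have "sq (charge s) = d\<^sup>2 + ((\<Sum>x\<in>#mset bs. x\<^sup>2) + 2 * sum_list bs + int M)"
      by (simp add: sq_def st charge_def T'M image_mset.compositionality comp_def len)
    moreover have "phase (charge s) = 0" by (simp add: st charge_def T'M)
    ultimately show ?thesis using sum by (simp add: psi_def sq_st T'M) (simp add: st T'M)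
  qed
qed

lemma psi_sweep:
  assumes s: "s \<in> Z T" and s': "s' \<in> Z (Suc T)" "vals s' = vals (charge s)"
  shows "psi s' = psi s - 2 * dcoord s"
  using psi_charge[OF s] phase_charge[OF s] phase_Z[OF s'(1)] s'(2)
  by (simp add: psi_def sq_def)

text \<open>The top level is nonnegative and the phase is below \<open>M + 1\<close>, so the top
  value exceeds -1.\<close>

lemma top_val_nonneg:
  assumes "s \<in> Z T" shows "0 \<le> top_val s"
proof -
  have "0 < (int M + 1) * (top_val s + 1)"
    using level_top_nonneg[OF assms] phase_bounds[OF assms] by (simp add: level_def algebra_simps)
  then show ?thesis by (simp add: zero_less_mult_iff)
qed

text \<open>The initial \<open>d\<close> is arbitrary, possibly negative, so the first sweep may
  raise \<open>psi\<close>; this is the term \<open>- 2 * dcoord s\<close>. From then on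
  \<open>d\<close> is the top value, hence nonnegative, and \<open>psi\<close> cannot
  increase.\<close>

lemma sweeps_reach_top:
  assumes s: "s \<in> Z T"
  shows "\<exists>s' \<in> Z (T + j). ((1 / 2) ^ M) ^ j \<le> pmf (kernel_iter sweep j s) s' \<and>
    (0 < j \<longrightarrow> dcoord s' = top_val s' \<and> psi s' \<le> psi s - 2 * dcoord s)"
proof (induction j)
  case 0
  show ?case using s by (intro bexI[of _ s]) auto
next
  case (Suc j)
  then obtain s' where s': "s' \<in> Z (T + j)" "((1 / 2) ^ M) ^ j \<le> pmf (kernel_iter sweep j s) s'"
    "0 < j \<longrightarrow> dcoord s' = top_val s' \<and> psi s' \<le> psi s - 2 * dcoord s" by blast
  obtain s'' where s'': "s'' \<in> Z (Suc (T + j))" "vals s'' = vals (charge s')"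
    "(1 / 2) ^ M \<le> pmf (sweep s') s''" "dcoord s'' = top_val s''"
    using pmf_sweep_reach_top[OF s'(1)] .
  have psi: "psi s'' = psi s' - 2 * dcoord s'" by (rule psi_sweep[OF s'(1) s''(1,2)])
  have "psi s'' \<le> psi s - 2 * dcoord s"
  proof (cases "j = 0")
    case True
    have "s' = s"
    proof (rule ccontr)
      assume "s' \<noteq> s"
      then show False using s'(2) True by (simp add: pmf_return)
    qed
    then show ?thesis using psi by simp
  next
    case False
    then show ?thesis using s'(3) psi top_val_nonneg[OF s'(1)] by simp
  qed
  moreover have "((1 / 2) ^ M) ^ j * (1 / 2) ^ M \<le> pmf (kernel_iter sweep (j + 1) s) s''"
    using s'(2) s''(3) by (intro pmf_kernel_iter_add_ge) auto
  ultimately show ?case using s'' by (intro bexI[of _ s'']) (auto simp: mult.commute)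
qed

definition cycle :: "bdm_state \<Rightarrow> bdm_state pmf" where
  "cycle = kernel_iter sweep (M + 1)"

lemma cycle_reach_top:
  assumes s: "s \<in> Z 0"
  obtains s' where "s' \<in> Z 0" "((1 / 2) ^ M) ^ (M + 1) \<le> pmf (cycle s) s'"
    "dcoord s' = top_val s'" "psi s' \<le> psi s - 2 * dcoord s"
  using sweeps_reach_top[OF s, of "M + 1"] Z_cong[of "M + 1" 0] that
  by (auto simp: cycle_def simp del: power_Suc)

abbreviation s0 :: bdm_state where "s0 \<equiv> bdm_s0 M"

lemma s0_Z: "s0 \<in> Z 0"
  by (simp add: bdm_s0_def Z_iff sum_mset_sum_list sum_list_replicate)

lemma psi_Z0:
  assumes "s \<in> Z 0" "x \<in># vals s" shows "x\<^sup>2 \<le> psi s"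
  using square_le_sq[OF assms(2)] phase_Z[OF assms(1)] by (simp add: psi_def)

lemma eq_s0:
  assumes s: "s \<in> Z 0" and top: "top_val s \<le> 0" shows "s = s0"
proof -
  obtain bs d T t where st: "s = (bs, d, T, t)" by (cases s)
  have zero: "x = 0" if x: "x \<in># vals s" for x
  proof -
    obtain R where R: "vals s = add_mset x R" using x by (metis insert_DiffM)
    have "\<Sum>\<^sub># R \<le> int (size R) * 0"
      using sum_mset_image_le[of R "\<lambda>x. x" 0] le_top_val[of _ s] top R by fastforce
    moreover have "\<Sum>\<^sub># (vals s) = 0" using s by (cases s) (simp add: Z_iff)
    ultimately have "0 \<le> x" using R by simp
    then show ?thesis using le_top_val[OF x] top by simp
  qed
  then have "d = 0" "\<And>x. x \<in> set bs \<Longrightarrow> x = 0" by (auto simp: st)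
  moreover have "length bs = M" "T = 0" "t = M + 1" using s by (auto simp: st Z_iff)
  ultimately show ?thesis by (simp add: st bdm_s0_def replicate_eqI)
qed

text \<open>As long as the top value is positive, a cycle lowers \<open>psi\<close> by at least 2.
  At \<open>s0\<close> the followed path stays put, so exactly \<open>n\<close> cycles work for
  every admissible \<open>s\<close>; the atom condition requires such a common number.\<close>

lemma reach_s0:
  assumes "s \<in> Z 0" "dcoord s = top_val s" "psi s \<le> 2 * int n"
  shows "(((1 / 2) ^ M) ^ (M + 1)) ^ n \<le> pmf (kernel_iter cycle n s) s0"
  using assms
proof (induction n arbitrary: s)
  case 0
  have "psi s \<le> 0" using 0(3) by simp
  then have "(top_val s)\<^sup>2 \<le> 0" using psi_Z0[OF 0(1) top_val_in] by linarith
  then have "s = s0" using eq_s0[OF 0(1)] by simp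
  then show ?case by simp
next
  case (Suc n)
  obtain s' where s': "s' \<in> Z 0" "((1 / 2) ^ M) ^ (M + 1) \<le> pmf (cycle s) s'"
    "dcoord s' = top_val s'" "psi s' \<le> psi s - 2 * dcoord s"
    using cycle_reach_top[OF Suc.prems(1)] .
  have "psi s' \<le> 2 * int n"
  proof (cases "top_val s \<le> 0")
    case True
    then have "s = s0" using eq_s0[OF Suc.prems(1)] by simp
    then have "psi s = 0" "dcoord s = 0"
      by (auto simp: psi_def sq_def bdm_s0_def sum_mset_replicate_mset)
    then show ?thesis using s'(4) by simp
  next
    case False
    then show ?thesis using s'(4) Suc.prems by simp
  qed
  then have "(((1 / 2) ^ M) ^ (M + 1)) ^ n \<le> pmf (kernel_iter cycle n s') s0"
    using Suc.IH s' by blast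
  then have "((1 / 2) ^ M) ^ (M + 1) * (((1 / 2) ^ M) ^ (M + 1)) ^ n
      \<le> pmf (kernel_iter cycle (1 + n) s) s0"
    using s'(2) by (intro pmf_kernel_iter_add_ge) (auto simp del: power_Suc)
  then show ?case by simp
qed

lemma cycle_atom:
  "\<exists>n \<alpha>. 0 < n \<and> 0 < \<alpha> \<and> (\<forall>s\<in>Z 0. W s \<le> R \<longrightarrow> \<alpha> \<le> pmf (kernel_iter cycle n s) s0)"
proof -
  obtain L where L: "0 < L" "\<And>s T. s \<in> Z T \<Longrightarrow> of_int (sq s) + real M \<le> L * energy s"
    using sq_le_energy by blast
  \<comment> \<open>One cycle brings \<open>d\<close> to the top, with
    \<open>psi s' \<le> psi s - 2 * dcoord s\<close>. As \<open>- 2 * d \<le> d\<^sup>2 + 1\<close>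
    and \<open>d\<^sup>2 \<le> psi s\<close>, this is at most \<open>2 * psi s + 1\<close>, hence at
    most \<open>2 * k\<close>.\<close>
  define k where "k = nat \<lceil>L * R\<rceil> + 1"
  define \<delta> where "\<delta> = ((1 / 2 :: real) ^ M) ^ (M + 1)"
  have \<delta>: "0 < \<delta>" by (simp add: \<delta>_def)
  have "\<delta> * \<delta> ^ k \<le> pmf (kernel_iter cycle (1 + k) s) s0" if s: "s \<in> Z 0" and R: "W s \<le> R" for s
  proof -
    obtain s' where s': "s' \<in> Z 0" "\<delta> \<le> pmf (cycle s) s'"
      "dcoord s' = top_val s'" "psi s' \<le> psi s - 2 * dcoord s"
      unfolding \<delta>_def using cycle_reach_top[OF s] .
    have "real_of_int (psi s) \<le> L * energy s"
      using L(2)[OF s] phase_Z[OF s] by (simp add: psi_def)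
    also have "\<dots> \<le> L * R" using energy_le_W[of s] R L(1) by (intro mult_left_mono) auto
    finally have "psi s \<le> \<lceil>L * R\<rceil>" by linarith
    moreover have "0 \<le> (dcoord s + 1)\<^sup>2" by simp
    then have "- 2 * dcoord s \<le> (dcoord s)\<^sup>2 + 1" by (simp add: power2_eq_square algebra_simps)
    moreover have "(dcoord s)\<^sup>2 \<le> psi s" by (rule psi_Z0[OF s dcoord_in_vals])
    moreover have "\<lceil>L * R\<rceil> \<le> int (nat \<lceil>L * R\<rceil>)" by simp
    moreover have "2 * int k = 2 * int (nat \<lceil>L * R\<rceil>) + 2" by (simp add: k_def)
    ultimately have "psi s' \<le> 2 * int k" using s'(4) by linarith
    then have "\<delta> ^ k \<le> pmf (kernel_iter cycle k s') s0"
      unfolding \<delta>_def using s' by (intro reach_s0)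
    then show ?thesis using s'(2) \<delta> by (intro pmf_kernel_iter_add_ge) auto
  qed
  then show ?thesis using \<delta> by (intro exI[of _ "1 + k"] exI[of _ "\<delta> * \<delta> ^ k"]) auto
qed

sublocale Cy: finite_kernel cycle "Z 0"
proof
  show "set_pmf (cycle s) \<subseteq> Z 0" if "s \<in> Z 0" for s
    using iter_sweep_support[OF that, of "M + 1"] Z_cong[of "M + 1" 0] by (simp add: cycle_def)
  show "finite (set_pmf (cycle s))" if "s \<in> Z 0" for s
    unfolding cycle_def using that by (intro Sw.kernel_iter_fin) blast
qed

subsection \<open>Convergence and the average of \<open>d\<close>\<close>

definition at_phase :: "nat \<Rightarrow> nat \<Rightarrow> bdm_state pmf" where
  "at_phase T n = kernel_iter sweep ((M + 1) * n + T) s0"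

lemma at_phase_support: "set_pmf (at_phase T n) \<subseteq> Z T" "finite (set_pmf (at_phase T n))"
proof -
  have "Z (0 + ((M + 1) * n + T)) = Z T" by (rule Z_cong) (metis add_0 mod_mult_self4)
  then show "set_pmf (at_phase T n) \<subseteq> Z T"
    using iter_sweep_support[OF s0_Z] unfolding at_phase_def by metis
  show "finite (set_pmf (at_phase T n))"
    unfolding at_phase_def using s0_Z by (intro Sw.kernel_iter_fin) blast
qed

text \<open>Harris' theorem is applied to cycles at phase 0 only. For phase \<open>T\<close> the
  test function is pulled back by \<open>T\<close> sweeps; by the drift and
  \<open>1 \<le> W\<close>, the result is bounded by \<open>(1 + C') * W\<close>, whence the
  division by \<open>1 + C'\<close>.\<close>

lemma at_phase_Cauchy:
  assumes "0 < e"
  shows "\<exists>n0. \<forall>i\<ge>n0. \<forall>j\<ge>n0. \<forall>f. (\<forall>x\<in>Z T. \<bar>f x\<bar> \<le> W x) \<longrightarrow>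
      \<bar>expect (at_phase T i) f - expect (at_phase T j) f\<bar> \<le> e"
proof -
  obtain \<gamma> C where \<gamma>: "0 \<le> \<gamma>" "\<gamma> < 1" and C: "0 \<le> C"
    and drift: "\<And>s T. s \<in> Z T \<Longrightarrow> expect (sweep s) W \<le> \<gamma> * W s + C"
    using sweep_drift by blast
  define C' where "C' = C / (1 - \<gamma>)"
  have C': "0 \<le> C'" using C \<gamma> by (simp add: C'_def)
  have iter: "expect (kernel_iter sweep n s) W \<le> \<gamma> ^ n * W s + C'" if "s \<in> Z 0" for n s
    unfolding C'_def using drift that by (intro Sw.drift_kernel_iter \<gamma> C) auto
  have W1: "1 \<le> W s" if "s \<in> Z T" for s T
    using energy_ge_1[OF that] energy_le_W[of s] by simp
  have driftC: "expect (cycle s) W \<le> \<gamma> * W s + C'" if s: "s \<in> Z 0" for s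
  proof -
    have "\<gamma> ^ (M + 1) \<le> \<gamma> ^ 1" using \<gamma> by (intro power_decreasing) auto
    then have "\<gamma> ^ (M + 1) * W s \<le> \<gamma> * W s" using W1[OF s] by (intro mult_right_mono) auto
    then show ?thesis using iter[OF s, of "M + 1"] by (simp add: cycle_def)
  qed
  have "0 < e / (1 + C')" using assms C' by simp
  moreover have "0 \<le> W s" if "s \<in> Z 0" for s using W1[OF that] by simp
  ultimately obtain n0 where n0: "\<And>i j f. n0 \<le> i \<Longrightarrow> n0 \<le> j \<Longrightarrow> \<forall>x\<in>Z 0. \<bar>f x\<bar> \<le> W x \<Longrightarrow>
      \<bar>expect (kernel_iter cycle i s0) f - expect (kernel_iter cycle j s0) f\<bar> \<le> e / (1 + C')"
    using Cy.harris_uniformly_Cauchy[OF driftC _ \<gamma> C' cycle_atom s0_Z, of "e / (1 + C')"] by blast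
  have "\<bar>expect (at_phase T i) f - expect (at_phase T j) f\<bar> \<le> e"
    if ij: "n0 \<le> i" "n0 \<le> j" and f: "\<forall>x\<in>Z T. \<bar>f x\<bar> \<le> W x" for i j f
  proof -
    define g where "g = (\<lambda>s. expect (kernel_iter sweep T s) f / (1 + C'))"
    have E: "expect (at_phase T n) f = (1 + C') * expect (kernel_iter cycle n s0) g" for n
    proof -
      have "expect (at_phase T n) f
          = expect (kernel_iter sweep ((M + 1) * n) s0) (\<lambda>s. expect (kernel_iter sweep T s) f)"
        unfolding at_phase_def using s0_Z by (intro Sw.expect_kernel_iter_add) blast
      also have "kernel_iter sweep ((M + 1) * n) s0 = kernel_iter cycle n s0"
        unfolding cycle_def by (rule kernel_iter_mult)
      finally show ?thesis using C' by (simp add: g_def)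
    qed
    have "\<bar>g s\<bar> \<le> W s" if s: "s \<in> Z 0" for s
    proof -
      have "\<bar>expect (kernel_iter sweep T s) f\<bar> \<le> expect (kernel_iter sweep T s) W"
        using f iter_sweep_support[OF s, of T] s
        by (intro abs_expect_le Sw.kernel_iter_fin) auto
      also have "\<dots> \<le> \<gamma> ^ T * W s + C'" by (rule iter[OF s])
      also have "\<dots> \<le> 1 * W s + C' * W s"
        using \<gamma> C' W1[OF s] mult_left_mono[of 1 "W s" C']
        by (intro add_mono mult_right_mono power_le_one) auto
      finally show ?thesis using C' by (simp add: g_def field_simps)
    qed
    then have "\<bar>expect (kernel_iter cycle i s0) g - expect (kernel_iter cycle j s0) g\<bar> \<le> e / (1 + C')"
      using n0[OF ij] by blast
    then have "(1 + C') * \<bar>expect (kernel_iter cycle i s0) g - expect (kernel_iter cycle j s0) g\<bar> \<le> e"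
      using C' by (simp add: field_simps)
    then show ?thesis
      unfolding E right_diff_distrib[symmetric] abs_mult using C' by simp
  qed
  then show ?thesis by blast
qed

text \<open>One \<open>m\<close> serves all \<open>f\<close> and \<open>c\<close>. The factor
  \<open>c\<close> admits \<open>dcoord\<close> and \<open>psi\<close>, which are dominated by
  \<open>W\<close> only up to a constant.\<close>

lemma at_phase_limit:
  "\<exists>m. (\<forall>s. (\<lambda>n. pmf (at_phase T n) s) \<longlonglongrightarrow> m s) \<and>
    (\<forall>f c. 0 < c \<longrightarrow> (\<forall>s\<in>Z T. \<bar>f s\<bar> \<le> c * W s) \<longrightarrow> (\<lambda>s. m s * f s) summable_on Z T \<and>
       (\<lambda>n. expect (at_phase T n) f) \<longlonglongrightarrow> (\<Sum>\<^sub>\<infinity>s\<in>Z T. m s * f s))"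
proof -
  have W1: "1 \<le> W s" if "s \<in> Z T" for s
    using energy_ge_1[OF that] energy_le_W[of s] by simp
  obtain m where m: "\<And>s. (\<lambda>n. pmf (at_phase T n) s) \<longlonglongrightarrow> m s"
    "\<And>f. (\<And>s. s \<in> Z T \<Longrightarrow> \<bar>f s\<bar> \<le> W s) \<Longrightarrow> (\<lambda>s. m s * f s) summable_on Z T"
    "\<And>f. (\<And>s. s \<in> Z T \<Longrightarrow> \<bar>f s\<bar> \<le> W s) \<Longrightarrow>
       (\<lambda>n. expect (at_phase T n) f) \<longlonglongrightarrow> (\<Sum>\<^sub>\<infinity>s\<in>Z T. m s * f s)"
    using weighted_l1_limit[OF at_phase_support(2) at_phase_support(1) W1 at_phase_Cauchy] by blast
  show ?thesis
  proof (intro exI[of _ m] conjI allI impI m(1))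
    fix f :: "bdm_state \<Rightarrow> real" and c :: real
    assume c: "0 < c" and f: "\<forall>s\<in>Z T. \<bar>f s\<bar> \<le> c * W s"
    have f': "\<bar>f s / c\<bar> \<le> W s" if "s \<in> Z T" for s
      using f that c by (simp add: pos_divide_le_eq mult.commute)
    have e: "(\<lambda>s. m s * f s) = (\<lambda>s. c * (m s * (f s / c)))" using c by auto
    show "(\<lambda>s. m s * f s) summable_on Z T"
      unfolding e using m(2)[OF f'] by (rule summable_on_cmult_right)
    have "(\<lambda>n. c * expect (at_phase T n) (\<lambda>s. f s / c)) \<longlonglongrightarrow> c * (\<Sum>\<^sub>\<infinity>s\<in>Z T. m s * (f s / c))"
      by (intro tendsto_intros m(3) f')
    then show "(\<lambda>n. expect (at_phase T n) f) \<longlonglongrightarrow> (\<Sum>\<^sub>\<infinity>s\<in>Z T. m s * f s)"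
      unfolding e using c by (simp add: infsum_cmult_right'[symmetric])
  qed
qed

section \<open>\<open>bdm_mu_inf\<close> as the limit along one residue class of times\<close>

lemma bdm_mu_eq: "bdm_mu M q \<tau> = kernel_iter step \<tau> s0"
  by (simp add: bdm_mu_def kernel_iter_def)

lemma bdm_mu_at_phase: "bdm_mu M q ((M + 1) * ((M + 1) * n + T)) = at_phase T n"
  unfolding bdm_mu_eq at_phase_def sweep_def by (rule kernel_iter_mult)

text \<open>The time determines \<open>t\<close> and \<open>T\<close>. A remainder
  \<open>r > 0\<close> modulo \<open>M + 1\<close> means \<open>t = r\<close>, which differs from
  \<open>M + 1\<close>; for remainder 0 the number of sweeps modulo \<open>M + 1\<close> is the
  phase.\<close>

lemma bdm_mu_off_phase:
  assumes s: "s \<in> Z T" and T: "T \<le> M" and off: "\<And>n. \<tau> \<noteq> (M + 1) * ((M + 1) * n + T)"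
  shows "pmf (bdm_mu M q \<tau>) s = 0"
proof (rule ccontr)
  define j where "j = \<tau> div (M + 1)"
  define r where "r = \<tau> mod (M + 1)"
  have \<tau>: "\<tau> = (M + 1) * j + r" unfolding j_def r_def by (rule mult_div_mod_eq[symmetric])
  have r: "r < M + 1" unfolding r_def by (rule mod_less_divisor) simp
  assume "pmf (bdm_mu M q \<tau>) s \<noteq> 0"
  then have "s \<in> set_pmf (kernel_iter step \<tau> s0)" by (simp add: bdm_mu_eq set_pmf_iff)
  then obtain u where u: "u \<in> set_pmf (kernel_iter sweep j s0)" "s \<in> set_pmf (kernel_iter step r u)"
    by (auto simp: \<tau> kernel_iter_add kernel_iter_mult sweep_def simp del: mult_Suc)
  have uZ: "u \<in> Z j" using iter_sweep_support[OF s0_Z, of j] u(1) by auto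
  show False
  proof (cases r)
    case 0
    then have "s \<in> Z j" using u(2) uZ by simp
    then have "j mod (M + 1) = T mod (M + 1)" using phase_Z[OF s] phase_Z[of s j] by (metis of_nat_eq_iff)
    then have "j = (M + 1) * (j div (M + 1)) + T"
      using T mult_div_mod_eq[of "M + 1" j] by simp
    then show False using off[of "j div (M + 1)"] \<tau> 0 by simp
  next
    case (Suc r')
    obtain bs d where c: "charge u = (bs, d, int (Suc j mod (M + 1)), 1)" "length bs = M"
      using charge_Z[OF uZ] by metis
    have "s \<in> set_pmf (kernel_iter step r' (charge u))"
      using u(2) by (simp add: Suc kernel_iter_Suc' step_Z[OF uZ] bind_return_pmf)
    then obtain bs' d' T' where "s = (bs', d', T', r)"
      using compare_phase[of s r' bs d "int (Suc j mod (M + 1))" 1] c r Suc by auto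
    then show False using s r by (simp add: Z_iff)
  qed
qed

lemma bdm_mu_inf_eq:
  assumes s: "s \<in> Z T" and T: "T \<le> M" and lim: "(\<lambda>n. pmf (at_phase T n) s) \<longlonglongrightarrow> l"
  shows "bdm_mu_inf M q s = l"
proof -
  define g where "g = (\<lambda>n. (M + 1) * ((M + 1) * n + T))"
  have "strict_mono g" unfolding g_def
    by (intro strict_monoI mult_strict_left_mono add_strict_right_mono) auto
  then have "limsup (\<lambda>\<tau>. ereal (pmf (bdm_mu M q \<tau>) s)) = ereal l"
  proof (rule limsup_along_subsequence)
    show "(\<lambda>n. pmf (bdm_mu M q (g n)) s) \<longlonglongrightarrow> l"
      using lim unfolding g_def bdm_mu_at_phase .
    show "pmf (bdm_mu M q n) s = 0" if "n \<notin> range g" for n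
      using that by (intro bdm_mu_off_phase[OF s T]) (auto simp: g_def)
  qed simp
  then show ?thesis by (simp add: bdm_mu_inf_def)
qed

section \<open>Telescoping \<open>psi\<close> over a cycle\<close>

lemma expect_psi_sweep:
  "expect (kernel_iter sweep (Suc j) s0) (\<lambda>s. of_int (psi s))
     = expect (kernel_iter sweep j s0) (\<lambda>s. of_int (psi s))
       - 2 * expect (kernel_iter sweep j s0) (\<lambda>s. of_int (dcoord s))"
proof -
  let ?p = "kernel_iter sweep j s0"
  have sub: "set_pmf ?p \<subseteq> Z j" using iter_sweep_support[OF s0_Z, of j] by simp
  have fin: "finite (set_pmf ?p)" using s0_Z by (intro Sw.kernel_iter_fin) blast
  have "expect (kernel_iter sweep (Suc j) s0) (\<lambda>s. of_int (psi s))
      = expect ?p (\<lambda>s. expect (sweep s) (\<lambda>s. of_int (psi s)))"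
    using s0_Z by (intro Sw.expect_kernel_iter_Suc) blast
  also have "\<dots> = expect ?p (\<lambda>s. of_int (psi s) - 2 * of_int (dcoord s))"
  proof (rule expect_cong)
    fix s assume "s \<in> set_pmf ?p"
    then have s: "s \<in> Z j" using sub by blast
    have "expect (sweep s) (\<lambda>s'. of_int (psi s'))
        = expect (sweep s) (\<lambda>s'. of_int (psi s) - 2 * of_int (dcoord s))"
      using psi_sweep[OF s] sweep_support[OF s] by (intro expect_cong) simp
    then show "expect (sweep s) (\<lambda>s'. of_int (psi s')) = of_int (psi s) - 2 * of_int (dcoord s)"
      by simp
  qed
  also have "\<dots> = expect ?p (\<lambda>s. of_int (psi s)) - 2 * expect ?p (\<lambda>s. of_int (dcoord s))"
    using fin by (simp add: integrable_measure_pmf_finite)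
  finally show ?thesis .
qed

lemma sum_expect_dcoord:
  "2 * (\<Sum>k<K. expect (kernel_iter sweep (a + k) s0) (\<lambda>s. of_int (dcoord s)))
     = expect (kernel_iter sweep a s0) (\<lambda>s. of_int (psi s))
       - expect (kernel_iter sweep (a + K) s0) (\<lambda>s. of_int (psi s))"
  by (induction K) (simp_all add: expect_psi_sweep)

text \<open>An \<open>infsum\<close> over a family that is not summable is 0 by convention; the
  summability claim makes each \<open>dbar\<close> a genuine sum.\<close>

lemma dbar_average_zero:
  "(\<forall>T \<in> {0..int M}. (\<lambda>s. bdm_mu_inf M q s * real_of_int (dcoord s)) summable_on bdm_S_Tt M T (M + 1))
     \<and> (\<Sum>T \<in> {0..int M}. dbar M q T (M + 1)) = 0"
proof -
  obtain L where L: "0 < L" "\<And>s T. s \<in> Z T \<Longrightarrow> of_int (sq s) + real M \<le> L * energy s"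
    using sq_le_energy by blast
  have sqW: "of_int (sq s) + real M \<le> L * W s" if "s \<in> Z T" for s T
    using L(2)[OF that] mult_left_mono[OF energy_le_W[of s], of L] L(1) by linarith
  have dW: "\<bar>real_of_int (dcoord s)\<bar> \<le> L * W s" if s: "s \<in> Z T" for s T
  proof -
    have "(dcoord s)\<^sup>2 \<le> sq s" by (rule square_le_sq[OF dcoord_in_vals])
    moreover have "\<bar>dcoord s\<bar> \<le> (dcoord s)\<^sup>2"
      using self_le_power[of "\<bar>dcoord s\<bar>" 2] by (cases "dcoord s = 0") auto
    ultimately have "real_of_int \<bar>dcoord s\<bar> \<le> real_of_int (sq s)" by linarith
    then show ?thesis using sqW[OF s] by simp
  qed
  have psiW: "\<bar>real_of_int (psi s)\<bar> \<le> L * W s" if s: "s \<in> Z T" for s T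
  proof -
    have "\<bar>psi s\<bar> \<le> sq s + int M" using sq_nonneg[of s] phase_bounds[OF s] by (simp add: psi_def)
    then have "real_of_int \<bar>psi s\<bar> \<le> real_of_int (sq s + int M)" by (simp only: of_int_le_iff)
    then show ?thesis using sqW[OF s] by simp
  qed
  have Zk: "bdm_S_Tt M (int k) (M + 1) = Z k" if "k \<le> M" for k
    using that by (simp add: Z_def)
  have main: "(\<lambda>s. bdm_mu_inf M q s * real_of_int (dcoord s)) summable_on Z k \<and>
      (\<lambda>n. expect (at_phase k n) (\<lambda>s. of_int (dcoord s))) \<longlonglongrightarrow> dbar M q (int k) (M + 1)"
    if k: "k \<le> M" for k
  proof -
    obtain m where m: "\<And>s. (\<lambda>n. pmf (at_phase k n) s) \<longlonglongrightarrow> m s"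
      and conv: "\<And>f c. 0 < c \<Longrightarrow> \<forall>s\<in>Z k. \<bar>f s\<bar> \<le> c * W s \<Longrightarrow> (\<lambda>s. m s * f s) summable_on Z k \<and>
        (\<lambda>n. expect (at_phase k n) f) \<longlonglongrightarrow> (\<Sum>\<^sub>\<infinity>s\<in>Z k. m s * f s)"
      using at_phase_limit[of k] by blast
    have conv_d: "(\<lambda>s. m s * of_int (dcoord s)) summable_on Z k \<and>
        (\<lambda>n. expect (at_phase k n) (\<lambda>s. of_int (dcoord s)))
          \<longlonglongrightarrow> (\<Sum>\<^sub>\<infinity>s\<in>Z k. m s * of_int (dcoord s))"
      by (rule conv[OF L(1)]) (use dW in blast)
    have mu: "bdm_mu_inf M q s = m s" if "s \<in> Z k" for s
      by (rule bdm_mu_inf_eq[OF that k m])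
    have "(\<lambda>s. bdm_mu_inf M q s * real_of_int (dcoord s)) summable_on Z k"
      using conv_d mu by (simp cong: summable_on_cong)
    moreover have "dbar M q (int k) (M + 1) = (\<Sum>\<^sub>\<infinity>s\<in>Z k. m s * of_int (dcoord s))"
      unfolding dbar_def Zk[OF k] using mu by (intro infsum_cong) simp
    ultimately show ?thesis using conv_d by simp
  qed
  obtain m where conv: "\<And>f c. 0 < c \<Longrightarrow> \<forall>s\<in>Z 0. \<bar>f s\<bar> \<le> c * W s \<Longrightarrow>
      (\<lambda>s. m s * f s) summable_on Z 0 \<and>
      (\<lambda>n. expect (at_phase 0 n) f) \<longlonglongrightarrow> (\<Sum>\<^sub>\<infinity>s\<in>Z 0. m s * f s)"
    using at_phase_limit[of 0] by blast
  have "\<forall>s\<in>Z 0. \<bar>real_of_int (psi s)\<bar> \<le> L * W s" using psiW by blast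
  from conv[OF L(1) this] obtain l
    where l: "(\<lambda>n. expect (at_phase 0 n) (\<lambda>s. of_int (psi s))) \<longlonglongrightarrow> l" by blast
  have avg: "(\<lambda>n. 2 * (\<Sum>k<M + 1. expect (at_phase k n) (\<lambda>s. of_int (dcoord s))))
      \<longlonglongrightarrow> 2 * (\<Sum>k<M + 1. dbar M q (int k) (M + 1))"
    using main by (intro tendsto_intros) simp
  have telescope: "2 * (\<Sum>k<M + 1. expect (at_phase k n) (\<lambda>s. of_int (dcoord s)))
      = expect (at_phase 0 n) (\<lambda>s. of_int (psi s)) - expect (at_phase 0 (Suc n)) (\<lambda>s. of_int (psi s))" for n
    using sum_expect_dcoord[of "(M + 1) * n" "M + 1"]
    by (simp add: at_phase_def algebra_simps del: sum.lessThan_Suc)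
  \<comment> \<open>A cycle ends at phase 0 of the next one, so both terms belong to the same
    convergent sequence, shifted by one index.\<close>
  have "(\<lambda>n. expect (at_phase 0 n) (\<lambda>s. of_int (psi s))
      - expect (at_phase 0 (Suc n)) (\<lambda>s. of_int (psi s))) \<longlonglongrightarrow> l - l"
    by (intro tendsto_diff l LIMSEQ_Suc)
  with avg[unfolded telescope] have "2 * (\<Sum>k<M + 1. dbar M q (int k) (M + 1)) = l - l"
    by (rule LIMSEQ_unique)
  moreover have "(\<Sum>T \<in> {0..int M}. dbar M q T (M + 1)) = (\<Sum>k<M + 1. dbar M q (int k) (M + 1))"
    by (rule sum.reindex_bij_witness[of _ int nat]) auto
  moreover have "(\<lambda>s. bdm_mu_inf M q s * real_of_int (dcoord s)) summable_on bdm_S_Tt M T (M + 1)"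
    if "T \<in> {0..int M}" for T
    using main[of "nat T"] Zk[of "nat T"] that by auto
  ultimately show ?thesis by simp
qed

end

theorem theorem16:
  fixes M q :: nat
  assumes "M \<ge> 1" and "q \<ge> 2"
  shows "(\<forall>T \<in> {0..int M}. (\<lambda>s. bdm_mu_inf M q s * real_of_int (dcoord s))
             summable_on bdm_S_Tt M T (M + 1))
       \<and> (1 / real (M + 1)) * (\<Sum>T \<in> {0..int M}. dbar M q T (M + 1)) = 0"
proof -
  interpret bdm M q using assms by unfold_locales
  show ?thesis using dbar_average_zero by simp
qed

end
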